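(* Let $(X_\Delta,L_\Delta)$ be an $n$-dimensional polarized toric manifold. Then $(X_\Delta,L_\Delta)$ is asymptotically relatively Chow semistable in the toric sense if there is an $i_0$ such that for each integer $i\ge i_0$ there exists $s_i\in\mathbb{R}$ satisfying $$\frac{i^n(n+1)!\,\mathrm{Vol}(\Delta)}{E_\Delta(i)}\left(d_{i\Delta}+s_i\tilde\theta_{i\Delta}\right)\in\mathrm{Ch}(i\Delta).$$ Furthermore, it is asymptotically relatively Chow stable in the toric sense if there is an $i_0$ such that for each $i\ge i_0$ there exists $s_i\in\mathbb{R}$ satisfying $$\frac{i^n(n+1)!\,\mathrm{Vol}(\Delta)}{E_\Delta(i)}\left(d_{i\Delta}+s_i\tilde\theta_{i\Delta}\right)\in\mathrm{Int}(\mathrm{Ch}(i\Delta)).$$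
   Context: Polytope data. $\Delta=\{x\in\mathbb{R}^n:\langle l_j,x\rangle\le\lambda_j,\ j=1,\dots,d\}$ is an $n$-dimensional lattice polytope with $\lambda_j\in\mathbb{Z}$, $l_j\in\mathbb{Z}^n$ primitive, satisfying Delzant's condition (exactly $n$ facets at each vertex, with normals a $\mathbb{Z}$-basis); $(X_\Delta,L_\Delta)$ is the corresponding polarized toric manifold. $\mathrm{Vol}$, $dx$: Lebesgue measure; $d\sigma=|l_j|^{-1}d\sigma_0$ on the $j$-th facet, $d\sigma_0$ the standard surface measure; $\bar S=\int_{\partial\Delta}d\sigma/\mathrm{Vol}(\Delta)$. The function $\theta_\Delta$ (potential of the extremal vector field $V$) is the unique affine linear function such that $\mathcal{L}_\Delta(u)=\int_{\partial\Delta}u\,d\sigma-\int_\Delta(\bar S+\theta_\Delta)u\,dx$ vanishes for all affine linear $u$; in particular $\int_\Delta\theta_\Delta dx=0$. For a positive integer $i$ put $A_i=\Delta\cap(\mathbb{Z}/i)^n$, $E_\Delta(i)=\#A_i=\#(i\Delta\cap\mathbb{Z}^n)$ (Ehrhart polynomial), and $W(i\Delta)=\{\varphi:A_i\to\mathbb{R}\}\cong\mathbb{R}^{E_\Delta(i)}$. Put $\bar\theta_{i\Delta}=\frac1{E_\Delta(i)}\sum_{\mathbf{a}\in A_i}\theta_\Delta(\mathbf{a})$, and define $d_{i\Delta},\tilde\theta_{i\Delta}\in W(i\Delta)$ by $d_{i\Delta}(\mathbf{a})=1$, $\tilde\theta_{i\Delta}(\mathbf{a})=(\theta_\Delta(\mathbf{a})-\bar\theta_{i\Delta})/i$.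 Chow form. For an $n$-dimensional irreducible projective variety $X\subset\mathbb{CP}^N$ of degree $d$, the set of $(N-n-1)$-dimensional linear subspaces meeting $X$ is an irreducible hypersurface of degree $d$ (in Plücker coordinates) in the Grassmannian $\mathbb{G}(N-n-1,\mathbb{CP}^N)$; it is the zero locus of a section $R_X^*\in\mathbf{V}=H^0(\mathbb{G}(N-n-1,\mathbb{CP}^N),\mathcal{O}(d))$, unique up to scalar, called the Chow form. $\mathrm{GL}(N+1,\mathbb{C})$ acts naturally on $\mathbf{V}$. The Chow polytope is the weight polytope of $R_X^*$ under the diagonal torus $(\mathbb{C}^* )^{N+1}$: the convex hull in $\mathbb{R}^{N+1}$ of the characters $\chi$ such that the $\chi$-weight component of $R_X^*$ is nonzero. Convention: describing a linear subspace by $n+1$ linear forms, $R_X^*$ is a degree-$d$ polynomial in the maximal minors $[j_0\dots j_n]$ of the coefficient matrix, and $[j_0\dots j_n]$ has weight $e_{j_0}+\dots+e_{j_n}$. $\mathrm{Ch}(i\Delta)\subset W(i\Delta)$ is the Chow polytope of $X_\Delta$ embedded by $L_\Delta^i$, i.e. of the closure of $\{[z^{i\mathbf{a}}]_{\mathbf{a}\in A_i}: z\in(\mathbb{C}^* )^n\}$ in $\mathbb{CP}^{E_\Delta(i)-1}$. $\mathrm{Int}(\mathrm{Ch}(i\Delta))$ means its interior relative to its affine hull. Stability. For a reductive group $H$ acting linearly on a complex vector space, a nonzero vector $v$ is $H$-semistable if the closure of $H\cdot v$ does not contain $0$, and $H$-stable if $H\cdot v$ is closed. Let $T_{i\Delta}^{\mathbb{C}}$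 be the group of diagonal matrices in $\mathrm{SL}(E_\Delta(i),\mathbb{C})$, and let $\beta$ be the $\mathbb{C}^*$-action induced by $V$, with infinitesimal generator proportional to $\mathrm{diag}(\theta_\Delta(\mathbf{a})-\bar\theta_{i\Delta})_{\mathbf{a}\in A_i}$. A vector is $T_{i\Delta}^{\mathbb{C}}$-semistable (stable) relative to $\beta$ if it is semistable (stable) for the subtorus of $T_{i\Delta}^{\mathbb{C}}$ whose Lie algebra is the orthogonal complement of that generator in $\mathrm{Lie}(T_{i\Delta}^{\mathbb{C}})$ under $\langle A,B\rangle=\mathrm{Tr}(AB)$. $(X_\Delta,L_\Delta)$ is asymptotically relatively Chow semistable (stable) in the toric sense if, for all sufficiently large $i$, the Chow form of $X_\Delta$ embedded by $L_\Delta^i$ is $T_{i\Delta}^{\mathbb{C}}$-semistable (stable) relative to $\beta$. *)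

theory Defs
  imports "HOL-Analysis.Analysis" "HOL-Library.Function_Algebras"
begin

section \<open>Functions as real vectors\<close>

text \<open>
  For a finite set \<open>J\<close> the space of maps \<open>J \<rightarrow> \<real>\<close> (or \<open>J \<rightarrow> \<complex>\<close>) is rendered as the space of
  functions on the ambient type that vanish off \<open>J\<close>. The topology on function types is the
  product topology; on every finite-dimensional linear subspace it induces the usual topology, and
  all such subspaces are closed.
\<close>

instantiation "fun" :: (type, real_vector) real_vector
begin

definition scaleR_fun :: "real \<Rightarrow> ('a \<Rightarrow> 'b) \<Rightarrow> 'a \<Rightarrow> 'b" where
  "scaleR_fun c f = (\<lambda>x. c *\<^sub>R f x)"

instance
  by standard (simp_all add: scaleR_fun_def fun_eq_iff scaleR_add_left scaleR_add_right)

end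

section \<open>Delzant lattice polytopes\<close>

definition int_vec :: "int ^ 'n \<Rightarrow> real ^ 'n" where
  "int_vec w = (\<chi> k. real_of_int (w $ k))"

definition polyhedron_of :: "nat \<Rightarrow> (nat \<Rightarrow> int ^ 'n) \<Rightarrow> (nat \<Rightarrow> int) \<Rightarrow> (real ^ 'n) set" where
  "polyhedron_of d l lam = {x. \<forall>j\<in>{1..d}. int_vec (l j) \<bullet> x \<le> real_of_int (lam j)}"

definition facet :: "nat \<Rightarrow> (nat \<Rightarrow> int ^ 'n) \<Rightarrow> (nat \<Rightarrow> int) \<Rightarrow> nat \<Rightarrow> (real ^ 'n) set" where
  "facet d l lam j = {x \<in> polyhedron_of d l lam. int_vec (l j) \<bullet> x = real_of_int (lam j)}"

definition integer_basis :: "nat set \<Rightarrow> (nat \<Rightarrow> int ^ 'n) \<Rightarrow> bool" where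
  "integer_basis J l \<longleftrightarrow>
    (\<forall>w. \<exists>!c. (\<forall>j. j \<notin> J \<longrightarrow> c j = 0) \<and> w = (\<Sum>j\<in>J. c j *s l j))"

definition delzant_polytope :: "nat \<Rightarrow> (nat \<Rightarrow> int ^ 'n) \<Rightarrow> (nat \<Rightarrow> int) \<Rightarrow> bool" where
  "delzant_polytope d l lam \<longleftrightarrow>
    polytope (polyhedron_of d l lam) \<and>
    aff_dim (polyhedron_of d l lam) = int CARD('n) \<and>
    (\<forall>v. v extreme_point_of polyhedron_of d l lam \<longrightarrow> v \<in> range int_vec) \<and>
    bij_betw (facet d l lam) {1..d} {F. F facet_of polyhedron_of d l lam} \<and>
    (\<forall>j\<in>{1..d}. Gcd (range (\<lambda>k. l j $ k)) = 1) \<and>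
    (\<forall>v. v extreme_point_of polyhedron_of d l lam \<longrightarrow>
      card {j \<in> {1..d}. v \<in> facet d l lam j} = CARD('n) \<and>
      integer_basis {j \<in> {1..d}. v \<in> facet d l lam j} l)"

definition Vol :: "(real ^ 'n) set \<Rightarrow> real" where
  "Vol S = measure lborel S"

text \<open>
  The standard surface measure on the hyperplane \<open>\<langle>p, x\<rangle> = c\<close>: the area of a Borel subset of the
  hyperplane is the volume of the right prism of height one over it. So it is the push-forward
  of Lebesgue measure on the slab of thickness one on one side of the hyperplane under orthogonal
  projection. For \<open>n = 1\<close> it is the unit point mass.
\<close>

definition surface_measure :: "real ^ 'n \<Rightarrow> real \<Rightarrow> (real ^ 'n) measure" where
  "surface_measure p c =
    distr (restrict_space lborel {x. c \<le> p \<bullet> x \<and> p \<bullet> x \<le> c + norm p}) borel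
      (\<lambda>x. x - ((p \<bullet> x - c) / (p \<bullet> p)) *\<^sub>R p)"

text \<open>The integral over the boundary with respect to \<open>d\<sigma> = |l\<^sub>j|\<inverse> d\<sigma>\<^sub>0\<close>.\<close>

definition boundary_integral ::
    "nat \<Rightarrow> (nat \<Rightarrow> int ^ 'n) \<Rightarrow> (nat \<Rightarrow> int) \<Rightarrow> (real ^ 'n \<Rightarrow> real) \<Rightarrow> real" where
  "boundary_integral d l lam u =
    (\<Sum>j=1..d. (LINT x : facet d l lam j | surface_measure (int_vec (l j)) (real_of_int (lam j)). u x)
                / norm (int_vec (l j)))"

definition S_bar :: "nat \<Rightarrow> (nat \<Rightarrow> int ^ 'n) \<Rightarrow> (nat \<Rightarrow> int) \<Rightarrow> real" where
  "S_bar d l lam = boundary_integral d l lam (\<lambda>_. 1) / Vol (polyhedron_of d l lam)"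

definition affine_function :: "(real ^ 'n \<Rightarrow> real) \<Rightarrow> bool" where
  "affine_function u \<longleftrightarrow> (\<exists>c. linear (\<lambda>x. u x - c))"

definition extremal_functional ::
    "nat \<Rightarrow> (nat \<Rightarrow> int ^ 'n) \<Rightarrow> (nat \<Rightarrow> int) \<Rightarrow> (real ^ 'n \<Rightarrow> real) \<Rightarrow> (real ^ 'n \<Rightarrow> real) \<Rightarrow> real" where
  "extremal_functional d l lam \<theta> u =
    boundary_integral d l lam u
      - (LINT x : polyhedron_of d l lam | lborel. (S_bar d l lam + \<theta> x) * u x)"

definition theta :: "nat \<Rightarrow> (nat \<Rightarrow> int ^ 'n) \<Rightarrow> (nat \<Rightarrow> int) \<Rightarrow> real ^ 'n \<Rightarrow> real" where
  "theta d l lam =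
    (THE \<theta>. affine_function \<theta> \<and> (\<forall>u. affine_function u \<longrightarrow> extremal_functional d l lam \<theta> u = 0))"

definition lattice_points :: "(real ^ 'n) set \<Rightarrow> nat \<Rightarrow> (real ^ 'n) set" where
  "lattice_points S i = {a \<in> S. \<forall>k. real i * a $ k \<in> \<int>}"

definition ehrhart :: "(real ^ 'n) set \<Rightarrow> nat \<Rightarrow> nat" where
  "ehrhart S i = card (lattice_points S i)"

definition theta_bar :: "nat \<Rightarrow> (nat \<Rightarrow> int ^ 'n) \<Rightarrow> (nat \<Rightarrow> int) \<Rightarrow> nat \<Rightarrow> real" where
  "theta_bar d l lam i =
    (\<Sum>a\<in>lattice_points (polyhedron_of d l lam) i. theta d l lam a)
      / real (ehrhart (polyhedron_of d l lam) i)"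

definition d_vec :: "nat \<Rightarrow> (nat \<Rightarrow> int ^ 'n) \<Rightarrow> (nat \<Rightarrow> int) \<Rightarrow> nat \<Rightarrow> real ^ 'n \<Rightarrow> real" where
  "d_vec d l lam i =
    (\<lambda>a. if a \<in> lattice_points (polyhedron_of d l lam) i then 1 else 0)"

definition theta_tilde :: "nat \<Rightarrow> (nat \<Rightarrow> int ^ 'n) \<Rightarrow> (nat \<Rightarrow> int) \<Rightarrow> nat \<Rightarrow> real ^ 'n \<Rightarrow> real" where
  "theta_tilde d l lam i =
    (\<lambda>a. if a \<in> lattice_points (polyhedron_of d l lam) i
         then (theta d l lam a - theta_bar d l lam i) / real i else 0)"

section \<open>Chow forms\<close>

text \<open>
  The homogeneous coordinates of the projective space are indexed by a finite set \<open>J\<close>. A projective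
  variety is represented by the set \<open>X\<close> of all its homogeneous coordinate vectors, i.e. by its
  affine cone without the origin; these vectors vanish off \<open>J\<close>.
\<close>

text \<open>Polynomial functions in the coordinates indexed by \<open>I\<close>.\<close>

inductive polynomial_in :: "'b set \<Rightarrow> (('b \<Rightarrow> complex) \<Rightarrow> complex) \<Rightarrow> bool" for I where
  const: "polynomial_in I (\<lambda>_. c)"
| coord: "i \<in> I \<Longrightarrow> polynomial_in I (\<lambda>x. x i)"
| add: "polynomial_in I p \<Longrightarrow> polynomial_in I q \<Longrightarrow> polynomial_in I (\<lambda>x. p x + q x)"
| mult: "polynomial_in I p \<Longrightarrow> polynomial_in I q \<Longrightarrow> polynomial_in I (\<lambda>x. p x * q x)"

definition projective_points :: "('a \<Rightarrow> complex) set \<Rightarrow> ('a \<Rightarrow> complex) set set" where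
  "projective_points X = (\<lambda>x. {y. \<exists>c. c \<noteq> 0 \<and> y = (\<lambda>j. c * x j)}) ` X"

text \<open>
  The degree of an \<open>n\<close>-dimensional variety: the number of points in which it meets a general linear
  subspace of codimension \<open>n\<close>, where \<open>L (r, j)\<close> is the \<open>j\<close>-th coefficient of the \<open>r\<close>-th linear form
  and general means off the zero locus of some nonzero polynomial in these coefficients.
\<close>

definition proj_degree :: "nat \<Rightarrow> 'a set \<Rightarrow> ('a \<Rightarrow> complex) set \<Rightarrow> nat" where
  "proj_degree n J X =
    (THE m. \<exists>P. polynomial_in ({..<n} \<times> J) P \<and> (\<exists>L. P L \<noteq> 0) \<and>
      (\<forall>L. P L \<noteq> 0 \<longrightarrow>
        (let Y = projective_points {x \<in> X. \<forall>r<n. (\<Sum>j\<in>J. L (r, j) * x j) = 0}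
         in finite Y \<and> card Y = m)))"

text \<open>
  A linear subspace of codimension \<open>n + 1\<close> is given by linear forms \<open>M r\<close>, where the index \<open>r\<close> runs
  over a finite type \<open>'r\<close> with \<open>n + 1\<close> elements and \<open>M r j\<close> is the \<open>j\<close>-th coefficient of \<open>M r\<close>.
\<close>

type_synonym ('r, 'a) linear_forms = "'r \<Rightarrow> 'a \<Rightarrow> complex"

definition plucker :: "('r::finite \<Rightarrow> 'a) \<Rightarrow> ('r, 'a) linear_forms \<Rightarrow> complex" where
  "plucker c M = det (\<chi> r s. M r (c s))"

text \<open>
  \<open>H\<^sup>0(\<G>, \<O>(m))\<close>: the polynomials that are homogeneous of degree \<open>m\<close> in the Pluecker coordinates,
  as functions of the linear forms.
\<close>

definition plucker_forms :: "'a set \<Rightarrow> nat \<Rightarrow> (('r::finite, 'a) linear_forms \<Rightarrow> complex) set" where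
  "plucker_forms J m =
    {F. \<exists>b. F = (\<lambda>M. \<Sum>q \<in> {..<m} \<rightarrow>\<^sub>E {c. range c \<subseteq> J}. b q * (\<Prod>k<m. plucker (q k) M))}"

definition independent_forms :: "'a set \<Rightarrow> ('r::finite, 'a) linear_forms \<Rightarrow> bool" where
  "independent_forms J M \<longleftrightarrow>
    (\<forall>b. (\<forall>j\<in>J. (\<Sum>r\<in>UNIV. b r * M r j) = 0) \<longrightarrow> (\<forall>r. b r = 0))"

abbreviation chow_space ::
    "'a set \<Rightarrow> ('a \<Rightarrow> complex) set \<Rightarrow> (('r::finite, 'a) linear_forms \<Rightarrow> complex) set" where
  "chow_space J X \<equiv> plucker_forms J (proj_degree (CARD('r) - 1) J X)"

definition is_chow_form ::
    "'a set \<Rightarrow> ('a \<Rightarrow> complex) set \<Rightarrow> (('r::finite, 'a) linear_forms \<Rightarrow> complex) \<Rightarrow> bool" where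
  "is_chow_form J X R \<longleftrightarrow>
    R \<in> chow_space J X \<and>
    (\<forall>M. independent_forms J M \<longrightarrow>
      (R M = 0 \<longleftrightarrow> (\<exists>x\<in>X. \<forall>r. (\<Sum>j\<in>J. M r j * x j) = 0)))"

text \<open>The Chow form is unique only up to a nonzero scalar.\<close>

definition chow_form ::
    "'a set \<Rightarrow> ('a \<Rightarrow> complex) set \<Rightarrow> ('r::finite, 'a) linear_forms \<Rightarrow> complex" where
  "chow_form J X = (SOME R. is_chow_form J X R)"

text \<open>
  The action \<open>(g F) M = F (M g)\<close> of the general linear group, for diagonal \<open>g\<close>. The Pluecker
  coordinate with columns \<open>j\<^sub>0, \<dots>, j\<^sub>n\<close> has weight \<open>e\<^bsub>j\<^sub>0\<^esub> + \<dots> + e\<^bsub>j\<^sub>n\<^esub>\<close>.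
\<close>

definition diag_act ::
    "('a \<Rightarrow> complex) \<Rightarrow> (('r, 'a) linear_forms \<Rightarrow> complex) \<Rightarrow> ('r, 'a) linear_forms \<Rightarrow> complex" where
  "diag_act t F = (\<lambda>M. F (\<lambda>r j. M r j * t j))"

definition weight_space ::
    "'a set \<Rightarrow> (('r, 'a) linear_forms \<Rightarrow> complex) set \<Rightarrow> ('a \<Rightarrow> int)
      \<Rightarrow> (('r, 'a) linear_forms \<Rightarrow> complex) set" where
  "weight_space J V \<xi> =
    {F \<in> V. \<forall>t. (\<forall>j\<in>J. t j \<noteq> 0) \<longrightarrow> diag_act t F = (\<lambda>M. (\<Prod>j\<in>J. t j powi \<xi> j) * F M)}"

text \<open>
  \<open>G\<close> is the decomposition of \<open>F\<close> into its weight components \<open>G \<xi>\<close>. Only finitely many of them are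
  nonzero, and the decomposition is unique. Characters of the torus are integer vectors that
  vanish off \<open>J\<close>.
\<close>

definition weight_decomposition ::
    "'a set \<Rightarrow> (('r, 'a) linear_forms \<Rightarrow> complex) set \<Rightarrow> (('r, 'a) linear_forms \<Rightarrow> complex)
      \<Rightarrow> (('a \<Rightarrow> int) \<Rightarrow> ('r, 'a) linear_forms \<Rightarrow> complex) \<Rightarrow> bool" where
  "weight_decomposition J V F G \<longleftrightarrow>
    (\<forall>\<xi>. G \<xi> \<in> weight_space J V \<xi>) \<and>
    (\<forall>\<xi>. G \<xi> \<noteq> 0 \<longrightarrow> (\<forall>j. j \<notin> J \<longrightarrow> \<xi> j = 0)) \<and>
    finite {\<xi>. G \<xi> \<noteq> 0} \<and> F = (\<Sum>\<xi> | G \<xi> \<noteq> 0. G \<xi>)"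

definition weight_polytope ::
    "'a set \<Rightarrow> (('r, 'a) linear_forms \<Rightarrow> complex) set \<Rightarrow> (('r, 'a) linear_forms \<Rightarrow> complex)
      \<Rightarrow> ('a \<Rightarrow> real) set" where
  "weight_polytope J V F =
    convex hull {(\<lambda>j. real_of_int (\<xi> j)) | \<xi>. \<exists>G. weight_decomposition J V F G \<and> G \<xi> \<noteq> 0}"

section \<open>Stability\<close>

definition torus_orbit ::
    "('a \<Rightarrow> complex) set \<Rightarrow> (('r, 'a) linear_forms \<Rightarrow> complex)
      \<Rightarrow> (('r, 'a) linear_forms \<Rightarrow> complex) set" where
  "torus_orbit H F = (\<lambda>t. diag_act t F) ` H"

definition semistable ::
    "('a \<Rightarrow> complex) set \<Rightarrow> (('r, 'a) linear_forms \<Rightarrow> complex) \<Rightarrow> bool" where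
  "semistable H F \<longleftrightarrow> F \<noteq> 0 \<and> 0 \<notin> closure (torus_orbit H F)"

definition stable ::
    "('a \<Rightarrow> complex) set \<Rightarrow> (('r, 'a) linear_forms \<Rightarrow> complex) \<Rightarrow> bool" where
  "stable H F \<longleftrightarrow> F \<noteq> 0 \<and> closed (torus_orbit H F)"

text \<open>
  Diagonal matrices are identified with their diagonals. The Lie algebra of the diagonal torus of
  \<open>SL(J)\<close> consists of the traceless diagonal matrices, and the trace form of two diagonal
  matrices is \<open>Tr (A B) = \<Sum>\<^sub>j A\<^sub>j B\<^sub>j\<close>.
\<close>

definition sl_torus_lie :: "'a set \<Rightarrow> ('a \<Rightarrow> complex) set" where
  "sl_torus_lie J = {w. (\<forall>j. j \<notin> J \<longrightarrow> w j = 0) \<and> (\<Sum>j\<in>J. w j) = 0}"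

definition trace_form :: "'a set \<Rightarrow> ('a \<Rightarrow> complex) \<Rightarrow> ('a \<Rightarrow> complex) \<Rightarrow> complex" where
  "trace_form J A B = (\<Sum>j\<in>J. A j * B j)"

text \<open>
  A torus is connected and commutative, hence it is the image of its Lie algebra under
  the exponential map. The diagonal entries off \<open>J\<close> are \<open>exp 0 = 1\<close>.
\<close>

definition relative_torus :: "'a set \<Rightarrow> ('a \<Rightarrow> complex) \<Rightarrow> ('a \<Rightarrow> complex) set" where
  "relative_torus J B = (\<lambda>w j. exp (w j)) ` {w \<in> sl_torus_lie J. trace_form J w B = 0}"

section \<open>Toric varieties\<close>

text \<open>
  The homogeneous coordinate vectors of the closure of the points with coordinates \<open>z\<^bsup>i a\<^esup>\<close>.
  Closures in projective space correspond to closures of cones in the complement of the origin.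
\<close>

definition toric_point :: "(real ^ 'n) set \<Rightarrow> nat \<Rightarrow> complex ^ 'n \<Rightarrow> real ^ 'n \<Rightarrow> complex" where
  "toric_point S i z =
    (\<lambda>a. if a \<in> lattice_points S i then (\<Prod>k\<in>UNIV. (z $ k) powi \<lfloor>real i * a $ k\<rfloor>) else 0)"

definition toric_variety :: "(real ^ 'n) set \<Rightarrow> nat \<Rightarrow> (real ^ 'n \<Rightarrow> complex) set" where
  "toric_variety S i =
    closure {(\<lambda>a. c * toric_point S i z a) | c z. c \<noteq> 0 \<and> (\<forall>k. z $ k \<noteq> 0)} - {0}"

text \<open>The \<open>n + 1\<close> linear forms are indexed by the type \<open>'n option\<close>.\<close>

definition toric_chow_form ::
    "(real ^ 'n) set \<Rightarrow> nat \<Rightarrow> ('n option, real ^ 'n) linear_forms \<Rightarrow> complex" where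
  "toric_chow_form S i = chow_form (lattice_points S i) (toric_variety S i)"

definition Ch :: "(real ^ 'n) set \<Rightarrow> nat \<Rightarrow> (real ^ 'n \<Rightarrow> real) set" where
  "Ch S i =
    weight_polytope (lattice_points S i) (chow_space (lattice_points S i) (toric_variety S i))
      (toric_chow_form S i)"

definition beta_generator ::
    "nat \<Rightarrow> (nat \<Rightarrow> int ^ 'n) \<Rightarrow> (nat \<Rightarrow> int) \<Rightarrow> nat \<Rightarrow> real ^ 'n \<Rightarrow> complex" where
  "beta_generator d l lam i =
    (\<lambda>a. if a \<in> lattice_points (polyhedron_of d l lam) i
         then complex_of_real (theta d l lam a - theta_bar d l lam i) else 0)"

definition toric_relative_torus ::
    "nat \<Rightarrow> (nat \<Rightarrow> int ^ 'n) \<Rightarrow> (nat \<Rightarrow> int) \<Rightarrow> nat \<Rightarrow> (real ^ 'n \<Rightarrow> complex) set" where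
  "toric_relative_torus d l lam i =
    relative_torus (lattice_points (polyhedron_of d l lam) i) (beta_generator d l lam i)"

definition asymptotically_relatively_chow_semistable ::
    "nat \<Rightarrow> (nat \<Rightarrow> int ^ 'n) \<Rightarrow> (nat \<Rightarrow> int) \<Rightarrow> bool" where
  "asymptotically_relatively_chow_semistable d l lam \<longleftrightarrow>
    (\<forall>\<^sub>F i in sequentially.
      semistable (toric_relative_torus d l lam i) (toric_chow_form (polyhedron_of d l lam) i))"

definition asymptotically_relatively_chow_stable ::
    "nat \<Rightarrow> (nat \<Rightarrow> int ^ 'n) \<Rightarrow> (nat \<Rightarrow> int) \<Rightarrow> bool" where
  "asymptotically_relatively_chow_stable d l lam \<longleftrightarrow>
    (\<forall>\<^sub>F i in sequentially.
      stable (toric_relative_torus d l lam i) (toric_chow_form (polyhedron_of d l lam) i))"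

end

theory Submission
  imports Defs
begin

text \<open>
  Only the weight decomposition of the Chow form matters. It exists as soon as the Chow polytope is
  nonempty, so no existence theorem for Chow forms is needed. The Lie algebra of the relative torus
  is orthogonal to \<open>d\<close> and to \<open>\<theta>\<close>, hence to the given point \<open>p\<close> of the Chow polytope.
  If \<open>p\<close> is a convex combination \<open>\<Sum> c \<zeta> \<zeta>\<close> of weights, then the product of the
  \<open>|a \<zeta>| powr c \<zeta>\<close>, where \<open>a \<zeta>\<close> are the coefficients along the weight components, is
  constant on the orbit; it keeps the orbit away from the origin. If \<open>p\<close> is an interior point, all
  \<open>c \<zeta>\<close> can be taken positive, and the coefficients stay nonzero on the closure of the orbit.
  Their moduli form the image of a linear space, which is closed, but their phases form a closed set
  only because the relative torus is an algebraic torus, that is, because \<open>\<theta>\<close> is rational.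
  This is so since \<open>\<theta>\<close> solves a linear system whose coefficients are moments of the polytope and
  of its facets, which are integrals of rational polynomials over rational polytopes.
\<close>

section \<open>Torus actions and weights\<close>

text \<open>The scalar in front of the point is forced: every weight of the Chow form has coordinate
  sum n + 1 times the degree, the degree is i^n n! Vol, and the entries of \<open>d_vec\<close> sum
  to the Ehrhart number while those of \<open>theta_tilde\<close> sum to 0. Orthogonality is
  homogeneous, so the scalar appears below as an arbitrary \<open>\<kappa>\<close>.

  Forms live in an infinite-dimensional function space with the product topology. The coefficients
  along the weight components are therefore extended to continuous maps on the whole space, built
  from evaluations and torus elements, and the span of the components is cut out by a closed
  equation.

  The generator is real, so the Lie algebra of the relative torus is W + iW for a real space W, and
  moduli and phases can be treated apart. For irrational \<theta> the phases could wind densely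
  around a larger compact torus.

  The moments are computed without triangulating the polytope: indicators of half-spaces stay in the
  integrand, which belongs to a class of piecewise polynomials that is closed under integrating out
  one variable over an interval.\<close>

lemma sum_fun_apply: "(\<Sum>i\<in>S. f i) x = (\<Sum>i\<in>S. f i x :: 'b :: comm_monoid_add)"
  by (induction S rule: infinite_finite_induct) auto

text \<open>
  A coordinate in which two weights differ gives a one-parameter subgroup that separates them, and
  a combination of its action with the identity kills one weight and fixes the other.
\<close>

lemma weight_component_continuous:
  fixes S :: "('a \<Rightarrow> int) set"
  assumes "finite J" "finite S" "\<xi> \<in> S" and supp: "\<And>\<eta> j. \<eta> \<in> S \<Longrightarrow> j \<notin> J \<Longrightarrow> \<eta> j = 0"
  obtains \<pi> :: "(('r::finite, 'a) linear_forms \<Rightarrow> complex) \<Rightarrow> ('r, 'a) linear_forms \<Rightarrow> complex"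
  where "continuous_on UNIV \<pi>"
    and "\<And>H. (\<And>\<zeta>. \<zeta> \<in> S \<Longrightarrow> H \<zeta> \<in> weight_space J UNIV \<zeta>) \<Longrightarrow> \<pi> (\<Sum>\<zeta>\<in>S. H \<zeta>) = H \<xi>"
proof -
  \<comment> \<open>Induction on the set U of weights already killed. The map multiplies the
    \<zeta>-component by \<open>c \<zeta>\<close>; the values of c outside U and \<xi> are left
    free, which keeps the induction simple.\<close>
  have "\<exists>\<pi> :: (('r, 'a) linear_forms \<Rightarrow> complex) \<Rightarrow> ('r, 'a) linear_forms \<Rightarrow> complex.
          \<exists>c. continuous_on UNIV \<pi> \<and> c \<xi> = 1 \<and> (\<forall>\<eta>\<in>U. c \<eta> = 0) \<and>
            (\<forall>H. (\<forall>\<zeta>\<in>S. H \<zeta> \<in> weight_space J UNIV \<zeta>) \<longrightarrow>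
              \<pi> (\<Sum>\<zeta>\<in>S. H \<zeta>) = (\<lambda>M. \<Sum>\<zeta>\<in>S. c \<zeta> * H \<zeta> M))"
    if "finite U" "U \<subseteq> S - {\<xi>}" for U
    using that
  proof (induction U)
    case empty
    show ?case
      by (rule exI[of _ "\<lambda>f. f"], rule exI[of _ "\<lambda>_. 1"]) (auto simp: sum_fun_apply fun_eq_iff)
  next
    case (insert \<eta> U)
    then obtain \<pi> :: "(('r, 'a) linear_forms \<Rightarrow> complex) \<Rightarrow> ('r, 'a) linear_forms \<Rightarrow> complex" and c
      where cont: "continuous_on UNIV \<pi>" and c: "c \<xi> = 1" "\<And>\<zeta>. \<zeta> \<in> U \<Longrightarrow> c \<zeta> = 0"
        and \<pi>: "\<And>H. (\<forall>\<zeta>\<in>S. H \<zeta> \<in> weight_space J UNIV \<zeta>) \<Longrightarrow>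
              \<pi> (\<Sum>\<zeta>\<in>S. H \<zeta>) = (\<lambda>M. \<Sum>\<zeta>\<in>S. c \<zeta> * H \<zeta> M)"
      by (auto; blast)
    from insert.prems have \<eta>: "\<eta> \<in> S" "\<eta> \<noteq> \<xi>" by auto
    then obtain k where k: "\<eta> k \<noteq> \<xi> k" by auto
    with \<eta> \<open>\<xi> \<in> S\<close> supp have kJ: "k \<in> J" by metis
    \<comment> \<open>The entry 2 works because its integer powers are pairwise distinct.\<close>
    define u :: "'a \<Rightarrow> complex" where "u = (\<lambda>j. if j = k then 2 else 1)"
    have ch: "(\<Prod>j\<in>J. u j powi \<zeta> j) = 2 powi \<zeta> k" for \<zeta> :: "'a \<Rightarrow> int"
    proof -
      have "(\<Prod>j\<in>J. u j powi \<zeta> j) = (\<Prod>j\<in>J. if j = k then 2 powi \<zeta> j else 1)"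
        by (intro prod.cong) (auto simp: u_def)
      then show ?thesis using kJ \<open>finite J\<close> by simp
    qed
    have neq: "(2::complex) powi \<xi> k \<noteq> 2 powi \<eta> k"
    proof
      assume "(2::complex) powi \<xi> k = 2 powi \<eta> k"
      then have "norm ((2::complex) powi \<xi> k) = norm ((2::complex) powi \<eta> k)" by simp
      then have eq: "(2::real) powi \<xi> k = 2 powi \<eta> k" by (simp add: norm_power_int)
      show False using k eq power_int_strict_increasing[of "\<xi> k" "\<eta> k" "2::real"]
        power_int_strict_increasing[of "\<eta> k" "\<xi> k" "2::real"] by linarith
    qed
    define D :: complex where "D = 2 powi \<xi> k - 2 powi \<eta> k"
    have D: "D \<noteq> 0" using neq by (simp add: D_def)
    \<comment> \<open>Only evaluations at two points are combined, so continuity in the product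
      topology is preserved. Dividing by D restores the factor 1 at \<xi>.\<close>
    define \<pi>' where "\<pi>' = (\<lambda>f M. (\<pi> f (\<lambda>r j. M r j * u j) - 2 powi \<eta> k * \<pi> f M) / D)"
    define c' where "c' = (\<lambda>\<zeta>. c \<zeta> * (2 powi \<zeta> k - 2 powi \<eta> k) / D)"
    have "continuous_on UNIV \<pi>'"
      unfolding \<pi>'_def
      using D by (intro continuous_on_coordinatewise_then_product continuous_on_divide continuous_on_diff
          continuous_on_mult continuous_on_const continuous_on_product_then_coordinatewise[OF cont]) auto
    moreover have "c' \<xi> = 1" using c D by (simp add: c'_def D_def)
    moreover have "\<forall>\<zeta>\<in>insert \<eta> U. c' \<zeta> = 0" using c by (auto simp: c'_def)
    moreover have "\<pi>' (\<Sum>\<zeta>\<in>S. H \<zeta>) = (\<lambda>M. \<Sum>\<zeta>\<in>S. c' \<zeta> * H \<zeta> M)"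
      if H: "\<forall>\<zeta>\<in>S. H \<zeta> \<in> weight_space J UNIV \<zeta>" for H
    proof
      fix M
      have act: "H \<zeta> (\<lambda>r j. M r j * u j) = 2 powi \<zeta> k * H \<zeta> M" if "\<zeta> \<in> S" for \<zeta>
      proof -
        have "diag_act u (H \<zeta>) = (\<lambda>M. (\<Prod>j\<in>J. u j powi \<zeta> j) * H \<zeta> M)"
          using H that by (auto simp: weight_space_def u_def)
        from fun_cong[OF this, of M] show ?thesis by (simp add: diag_act_def ch)
      qed
      have "\<pi>' (\<Sum>\<zeta>\<in>S. H \<zeta>) M
          = ((\<Sum>\<zeta>\<in>S. c \<zeta> * (2 powi \<zeta> k * H \<zeta> M)) - 2 powi \<eta> k * (\<Sum>\<zeta>\<in>S. c \<zeta> * H \<zeta> M)) / D"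
        unfolding \<pi>'_def \<pi>[OF H] by (simp add: act)
      also have "\<dots> = (\<Sum>\<zeta>\<in>S. c' \<zeta> * H \<zeta> M)"
        by (simp add: c'_def sum_distrib_left sum_subtractf[symmetric] sum_divide_distrib algebra_simps
            diff_divide_distrib)
      finally show "\<pi>' (\<Sum>\<zeta>\<in>S. H \<zeta>) M = (\<Sum>\<zeta>\<in>S. c' \<zeta> * H \<zeta> M)" .
    qed
    ultimately show ?case by blast
  qed
  from this[of "S - {\<xi>}"] obtain \<pi> :: "(('r, 'a) linear_forms \<Rightarrow> complex) \<Rightarrow> ('r, 'a) linear_forms \<Rightarrow> complex" and c
    where cont: "continuous_on UNIV \<pi>" and c: "c \<xi> = 1" "\<And>\<zeta>. \<zeta> \<in> S - {\<xi>} \<Longrightarrow> c \<zeta> = 0"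
      and \<pi>: "\<And>H. (\<forall>\<zeta>\<in>S. H \<zeta> \<in> weight_space J UNIV \<zeta>) \<Longrightarrow>
            \<pi> (\<Sum>\<zeta>\<in>S. H \<zeta>) = (\<lambda>M. \<Sum>\<zeta>\<in>S. c \<zeta> * H \<zeta> M)"
    using \<open>finite S\<close> by (auto; blast)
  show ?thesis
  proof (rule that[OF cont])
    fix H :: "('a \<Rightarrow> int) \<Rightarrow> ('r, 'a) linear_forms \<Rightarrow> complex"
    assume H: "\<And>\<zeta>. \<zeta> \<in> S \<Longrightarrow> H \<zeta> \<in> weight_space J UNIV \<zeta>"
    have "(\<Sum>\<zeta>\<in>S. c \<zeta> * H \<zeta> M) = H \<xi> M" for M
    proof -
      have "(\<Sum>\<zeta>\<in>S. c \<zeta> * H \<zeta> M) = (\<Sum>\<zeta>\<in>S. if \<zeta> = \<xi> then H \<zeta> M else 0)"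
        using c by (intro sum.cong) auto
      then show ?thesis using \<open>finite S\<close> \<open>\<xi> \<in> S\<close> by simp
    qed
    with \<pi>[of H] H show "\<pi> (\<Sum>\<zeta>\<in>S. H \<zeta>) = H \<xi>" by auto
  qed
qed

text \<open>In \<open>UNIV\<close> weight spaces are closed under scaling, whatever V is.\<close>

lemma weight_space_UNIV: "F \<in> weight_space J V \<xi> \<Longrightarrow> F \<in> weight_space J UNIV \<xi>"
  by (simp add: weight_space_def)

lemma weight_space_scale:
  "F \<in> weight_space J UNIV \<xi> \<Longrightarrow> (\<lambda>M. c * F M) \<in> weight_space J UNIV \<xi>"
  by (auto simp: weight_space_def diag_act_def fun_eq_iff)

text \<open>Padded with zeros, both decompositions are sums over the same finite set of weights, so
  one projection reads off the \<xi>-component of both.\<close>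

lemma weight_decomposition_unique:
  fixes F :: "('r::finite, 'a) linear_forms \<Rightarrow> complex"
  assumes "finite J" and G: "weight_decomposition J V F G" and G': "weight_decomposition J V F G'"
  shows "G = G'"
proof
  fix \<xi>
  let ?S = "{\<zeta>. G \<zeta> \<noteq> 0} \<union> {\<zeta>. G' \<zeta> \<noteq> 0}"
  show "G \<xi> = G' \<xi>"
  proof (cases "\<xi> \<in> ?S")
    case True
    have fin: "finite ?S" using G G' by (simp add: weight_decomposition_def)
    obtain \<pi> :: "(('r, 'a) linear_forms \<Rightarrow> complex) \<Rightarrow> ('r, 'a) linear_forms \<Rightarrow> complex"
      where \<pi>: "\<And>H. (\<And>\<zeta>. \<zeta> \<in> ?S \<Longrightarrow> H \<zeta> \<in> weight_space J UNIV \<zeta>) \<Longrightarrow> \<pi> (\<Sum>\<zeta>\<in>?S. H \<zeta>) = H \<xi>"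
    proof (rule weight_component_continuous[OF \<open>finite J\<close> fin True])
      show "\<eta> j = 0" if "\<eta> \<in> ?S" "j \<notin> J" for \<eta> j
        using that G G' by (auto simp: weight_decomposition_def)
    qed blast
    have "F = (\<Sum>\<zeta>\<in>?S. G \<zeta>)"
      using G fin by (auto simp: weight_decomposition_def intro!: sum.mono_neutral_left)
    moreover have "F = (\<Sum>\<zeta>\<in>?S. G' \<zeta>)"
      using G' fin by (auto simp: weight_decomposition_def intro!: sum.mono_neutral_left)
    ultimately show ?thesis
      using \<pi>[of G] \<pi>[of G'] G G' weight_space_UNIV unfolding weight_decomposition_def by metis
  qed auto
qed

text \<open>The polytope is defined through all decompositions; by uniqueness the finite support of
  a single one suffices.\<close>

lemma weight_polytope_eq:
  fixes F :: "('r::finite, 'a) linear_forms \<Rightarrow> complex"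
  assumes "finite J" "weight_decomposition J V F G"
  shows "weight_polytope J V F = convex hull ((\<lambda>\<xi> j. real_of_int (\<xi> j)) ` {\<xi>. G \<xi> \<noteq> 0})"
proof -
  have "weight_decomposition J V F G' \<longleftrightarrow> G' = G" for G'
    using weight_decomposition_unique[OF assms] assms(2) by metis
  then show ?thesis unfolding weight_polytope_def by (simp add: setcompr_eq_image)
qed

lemma weight_polytope_nonempty_decomposition:
  assumes "p \<in> weight_polytope J V F"
  obtains G where "weight_decomposition J V F G"
proof -
  have "{(\<lambda>j. real_of_int (\<xi> j)) | \<xi>. \<exists>G. weight_decomposition J V F G \<and> G \<xi> \<noteq> 0} \<noteq> {}"
    using assms unfolding weight_polytope_def by (metis convex_hull_empty empty_iff)
  then show ?thesis using that by blast
qed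

text \<open>The coefficient of \<open>G \<xi>\<close> is read off at a point where \<open>G \<xi>\<close> does not vanish.\<close>

lemma weight_coefficient_continuous:
  fixes F :: "('r::finite, 'a) linear_forms \<Rightarrow> complex"
  assumes "finite J" and G: "weight_decomposition J V F G" and \<xi>: "G \<xi> \<noteq> 0"
  shows "\<exists>\<kappa>. continuous_on UNIV \<kappa> \<and> (\<forall>c. \<kappa> (\<lambda>M. \<Sum>\<zeta> | G \<zeta> \<noteq> 0. c \<zeta> * G \<zeta> M) = c \<xi>)"
proof -
  let ?S = "{\<zeta>. G \<zeta> \<noteq> 0}"
  have fin: "finite ?S" and mem: "\<xi> \<in> ?S" using G \<xi> by (simp_all add: weight_decomposition_def)
  obtain \<pi> :: "(('r, 'a) linear_forms \<Rightarrow> complex) \<Rightarrow> ('r, 'a) linear_forms \<Rightarrow> complex"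
    where cont: "continuous_on UNIV \<pi>"
      and \<pi>: "\<And>H. (\<And>\<zeta>. \<zeta> \<in> ?S \<Longrightarrow> H \<zeta> \<in> weight_space J UNIV \<zeta>) \<Longrightarrow> \<pi> (\<Sum>\<zeta>\<in>?S. H \<zeta>) = H \<xi>"
  proof (rule weight_component_continuous[OF \<open>finite J\<close> fin mem])
    show "\<eta> j = 0" if "\<eta> \<in> ?S" "j \<notin> J" for \<eta> j
      using that G by (auto simp: weight_decomposition_def)
  qed blast
  obtain M0 where M0: "G \<xi> M0 \<noteq> 0" using \<xi> by (auto simp: fun_eq_iff)
  define \<kappa> where "\<kappa> = (\<lambda>f. \<pi> f M0 / G \<xi> M0)"
  show ?thesis
  proof (intro exI[of _ \<kappa>] conjI allI)
    show "continuous_on UNIV \<kappa>"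
      unfolding \<kappa>_def using M0
      by (intro continuous_on_divide continuous_on_const continuous_on_product_then_coordinatewise[OF cont]) auto
    fix c
    have "(\<lambda>M. \<Sum>\<zeta>\<in>?S. c \<zeta> * G \<zeta> M) = (\<Sum>\<zeta>\<in>?S. (\<lambda>M. c \<zeta> * G \<zeta> M))"
      by (simp add: fun_eq_iff sum_fun_apply)
    moreover have "\<pi> \<dots> = (\<lambda>M. c \<xi> * G \<xi> M)"
      using G by (intro \<pi> weight_space_scale) (auto simp: weight_decomposition_def intro: weight_space_UNIV)
    ultimately show "\<kappa> (\<lambda>M. \<Sum>\<zeta>\<in>?S. c \<zeta> * G \<zeta> M) = c \<xi>"
      using M0 by (simp add: \<kappa>_def)
  qed
qed

lemma weight_coefficients_continuous:
  fixes F :: "('r::finite, 'a) linear_forms \<Rightarrow> complex"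
  assumes "finite J" and G: "weight_decomposition J V F G"
  obtains \<kappa> :: "('a \<Rightarrow> int) \<Rightarrow> (('r, 'a) linear_forms \<Rightarrow> complex) \<Rightarrow> complex"
  where "\<And>\<xi>. G \<xi> \<noteq> 0 \<Longrightarrow> continuous_on UNIV (\<kappa> \<xi>)"
    and "\<And>\<xi> c. G \<xi> \<noteq> 0 \<Longrightarrow> \<kappa> \<xi> (\<lambda>M. \<Sum>\<zeta> | G \<zeta> \<noteq> 0. c \<zeta> * G \<zeta> M) = c \<xi>"
proof -
  have "\<forall>\<xi>\<in>{\<xi>. G \<xi> \<noteq> 0}. \<exists>\<kappa>. continuous_on UNIV \<kappa> \<and>
      (\<forall>c. \<kappa> (\<lambda>M. \<Sum>\<zeta> | G \<zeta> \<noteq> 0. c \<zeta> * G \<zeta> M) = c \<xi>)"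
    by (intro ballI weight_coefficient_continuous[OF assms]) simp
  from bchoice[OF this] obtain \<kappa> where
    "\<forall>\<xi>\<in>{\<xi>. G \<xi> \<noteq> 0}. continuous_on UNIV (\<kappa> \<xi>) \<and>
      (\<forall>c. \<kappa> \<xi> (\<lambda>M. \<Sum>\<zeta> | G \<zeta> \<noteq> 0. c \<zeta> * G \<zeta> M) = c \<xi>)" ..
  then show ?thesis by (intro that[of \<kappa>]) simp_all
qed

lemma diag_act_exp:
  assumes "finite J" and G: "weight_decomposition J V F G"
  shows "diag_act (\<lambda>j. exp (w j)) F
    = (\<lambda>M. \<Sum>\<zeta> | G \<zeta> \<noteq> 0. exp (\<Sum>j\<in>J. w j * of_int (\<zeta> j)) * G \<zeta> M)"
proof
  fix M
  have F: "F = (\<Sum>\<zeta> | G \<zeta> \<noteq> 0. G \<zeta>)" using G by (simp add: weight_decomposition_def)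
  have "G \<zeta> (\<lambda>r j. M r j * exp (w j)) = exp (\<Sum>j\<in>J. w j * of_int (\<zeta> j)) * G \<zeta> M" for \<zeta>
  proof -
    have "diag_act (\<lambda>j. exp (w j)) (G \<zeta>) = (\<lambda>M. (\<Prod>j\<in>J. exp (w j) powi \<zeta> j) * G \<zeta> M)"
      using G unfolding weight_decomposition_def weight_space_def by simp
    from fun_cong[OF this, of M] show ?thesis
      by (simp add: diag_act_def exp_power_int exp_sum \<open>finite J\<close> mult.commute)
  qed
  then show "diag_act (\<lambda>j. exp (w j)) F M
    = (\<Sum>\<zeta> | G \<zeta> \<noteq> 0. exp (\<Sum>j\<in>J. w j * of_int (\<zeta> j)) * G \<zeta> M)"
    by (subst F) (simp add: diag_act_def sum_fun_apply)
qed

text \<open>The hull of the empty set is empty, so some weight component is nonzero. Its coefficient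
  is 1 in F and 0 in the zero form.\<close>

lemma weight_polytope_nonzero:
  fixes F :: "('r::finite, 'a) linear_forms \<Rightarrow> complex"
  assumes "finite J" "p \<in> weight_polytope J V F"
  shows "F \<noteq> 0"
proof
  assume "F = 0"
  obtain G where G: "weight_decomposition J V F G"
    using weight_polytope_nonempty_decomposition assms(2) .
  then obtain \<xi> where \<xi>: "G \<xi> \<noteq> 0"
    using assms weight_polytope_eq[OF assms(1) G] by fastforce
  obtain \<kappa> :: "(('r, 'a) linear_forms \<Rightarrow> complex) \<Rightarrow> complex"
    where \<kappa>: "\<And>c. \<kappa> (\<lambda>M. \<Sum>\<zeta> | G \<zeta> \<noteq> 0. c \<zeta> * G \<zeta> M) = c \<xi>"
    using weight_coefficient_continuous[OF assms(1) G \<xi>] by auto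
  have "(\<lambda>M. \<Sum>\<zeta> | G \<zeta> \<noteq> 0. 1 * G \<zeta> M) = F"
    using G by (auto simp: weight_decomposition_def fun_eq_iff sum_fun_apply)
  moreover have "(\<lambda>M. \<Sum>\<zeta> | G \<zeta> \<noteq> 0. 0 * G \<zeta> M) = (0 :: ('r, 'a) linear_forms \<Rightarrow> complex)"
    by (auto simp: fun_eq_iff)
  ultimately show False
    using \<kappa>[of "\<lambda>_. 1"] \<kappa>[of "\<lambda>_. 0"] \<open>F = 0\<close> by simp
qed

lemma convex_hull_weights:
  fixes S :: "('a \<Rightarrow> int) set"
  assumes "finite S" "p \<in> convex hull ((\<lambda>\<xi> j. real_of_int (\<xi> j)) ` S)"
  obtains c where "\<And>\<zeta>. \<zeta> \<in> S \<Longrightarrow> 0 \<le> c \<zeta>" "sum c S = 1"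
    "\<And>j. p j = (\<Sum>\<zeta>\<in>S. c \<zeta> * real_of_int (\<zeta> j))"
proof -
  let ?emb = "\<lambda>\<xi> j. real_of_int (\<xi> j)"
  have inj: "inj_on ?emb S" by (auto simp: inj_on_def fun_eq_iff)
  from assms obtain v where v: "\<forall>x\<in>?emb ` S. 0 \<le> v x" "sum v (?emb ` S) = 1"
      "(\<Sum>x\<in>?emb ` S. v x *\<^sub>R x) = p"
    by (auto simp: convex_hull_finite)
  show ?thesis
  proof (rule that[of "v \<circ> ?emb"])
    show "0 \<le> (v \<circ> ?emb) \<zeta>" if "\<zeta> \<in> S" for \<zeta> using v that by auto
    show "sum (v \<circ> ?emb) S = 1" using v inj by (simp add: sum.reindex)
    show "p j = (\<Sum>\<zeta>\<in>S. (v \<circ> ?emb) \<zeta> * real_of_int (\<zeta> j))" for j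
      using v(3) inj by (auto simp: sum.reindex sum_fun_apply scaleR_fun_def)
  qed
qed

text \<open>The logarithm of the product is the real part of the pairing of w with the combination
  \<open>\<Sum> c \<zeta> \<zeta>\<close>, which vanishes by hypothesis.\<close>

lemma prod_exp_powr:
  assumes "finite S" "finite J"
    and sum: "(\<Sum>j\<in>J. w j * of_real (\<Sum>\<zeta>\<in>S. c \<zeta> * real_of_int (\<zeta> j))) = 0"
  shows "(\<Prod>\<zeta>\<in>S. norm (exp (\<Sum>j\<in>J. w j * of_int (\<zeta> j)) :: complex) powr c \<zeta>) = 1"
proof -
  have "(\<Prod>\<zeta>\<in>S. norm (exp (\<Sum>j\<in>J. w j * of_int (\<zeta> j)) :: complex) powr c \<zeta>)
      = exp (\<Sum>\<zeta>\<in>S. c \<zeta> * Re (\<Sum>j\<in>J. w j * of_int (\<zeta> j)))"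
    by (simp add: norm_exp_eq_Re powr_def exp_sum[OF \<open>finite S\<close>] del: Re_sum)
  also have "(\<Sum>\<zeta>\<in>S. c \<zeta> * Re (\<Sum>j\<in>J. w j * of_int (\<zeta> j)))
      = Re (\<Sum>j\<in>J. w j * of_real (\<Sum>\<zeta>\<in>S. c \<zeta> * real_of_int (\<zeta> j)))"
    by (simp add: sum_distrib_left) (subst sum.swap, simp add: algebra_simps)
  finally show ?thesis unfolding sum by simp
qed

text \<open>For a positive exponent t powr c tends to 0 as t does, in agreement with the value 0 of
  \<open>0 powr c\<close>.\<close>

lemma continuous_on_prod_powr:
  fixes f :: "'b \<Rightarrow> 'c::topological_space \<Rightarrow> complex"
  assumes "\<And>\<zeta>. \<zeta> \<in> S \<Longrightarrow> continuous_on A (f \<zeta>)" "\<And>\<zeta>. \<zeta> \<in> S \<Longrightarrow> c \<zeta> > 0"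
  shows "continuous_on A (\<lambda>x. \<Prod>\<zeta>\<in>S. norm (f \<zeta> x) powr c \<zeta>)"
  using assms by (intro continuous_on_prod continuous_on_powr' continuous_on_norm continuous_on_const) auto

text \<open>
  If \<open>p = \<Sum> c \<zeta> \<zeta>\<close> is a convex combination of weights, then the product of the
  \<open>|a \<zeta>| powr c \<zeta>\<close> over the coefficients \<open>a \<zeta>\<close> of a point of the orbit is constant. It would
  vanish at the origin.
\<close>

lemma semistable_if_weight_polytope_orthogonal:
  fixes F :: "('r::finite, 'a) linear_forms \<Rightarrow> complex"
  assumes "finite J" and p: "p \<in> weight_polytope J V F"
    and H: "\<And>t. t \<in> H \<Longrightarrow> \<exists>w. t = (\<lambda>j. exp (w j)) \<and> (\<Sum>j\<in>J. w j * complex_of_real (p j)) = 0"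
  shows "semistable H F"
  unfolding semistable_def
proof
  show "F \<noteq> 0" using weight_polytope_nonzero assms(1) p .
  obtain G where G: "weight_decomposition J V F G"
    using weight_polytope_nonempty_decomposition p .
  let ?S = "{\<zeta>. G \<zeta> \<noteq> 0}"
  have fin: "finite ?S" using G by (simp add: weight_decomposition_def)
  obtain c where c: "\<And>\<zeta>. \<zeta> \<in> ?S \<Longrightarrow> 0 \<le> c \<zeta>" and sumc: "sum c ?S = 1"
    and pS: "\<And>j. p j = (\<Sum>\<zeta>\<in>?S. c \<zeta> * real_of_int (\<zeta> j))"
    using convex_hull_weights[OF fin p[unfolded weight_polytope_eq[OF assms(1) G]]] by blast
  \<comment> \<open>Weights with coefficient 0 are dropped: t powr 0 is 1 for t > 0 but 0 at t = 0,
    so such a factor would be discontinuous exactly where the limit is taken.\<close>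
  define T where "T = {\<zeta>\<in>?S. c \<zeta> > 0}"
  have pj: "p j = (\<Sum>\<zeta>\<in>T. c \<zeta> * real_of_int (\<zeta> j))" for j
    unfolding pS T_def using c fin by (intro sum.mono_neutral_right) force+
  have finT: "finite T" using fin by (simp add: T_def)
  \<comment> \<open>An empty product would equal 1 at the origin as well.\<close>
  have "T \<noteq> {}"
  proof
    assume "T = {}"
    then have "c \<zeta> = 0" if "\<zeta> \<in> ?S" for \<zeta> using that c[OF that] by (force simp: T_def)
    then show False using sumc by simp
  qed
  obtain \<kappa> where \<kappa>S: "\<And>\<xi>. G \<xi> \<noteq> 0 \<Longrightarrow> continuous_on UNIV (\<kappa> \<xi>)"
      "\<And>\<xi> c. G \<xi> \<noteq> 0 \<Longrightarrow> \<kappa> \<xi> (\<lambda>M. \<Sum>\<zeta> | G \<zeta> \<noteq> 0. c \<zeta> * G \<zeta> M) = c \<xi>"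
    using weight_coefficients_continuous[OF assms(1) G] by blast
  have \<kappa>: "\<And>\<xi>. \<xi> \<in> T \<Longrightarrow> continuous_on UNIV (\<kappa> \<xi>)"
      "\<And>\<xi> c. \<xi> \<in> T \<Longrightarrow> \<kappa> \<xi> (\<lambda>M. \<Sum>\<zeta> | G \<zeta> \<noteq> 0. c \<zeta> * G \<zeta> M) = c \<xi>"
    using \<kappa>S by (auto simp: T_def)
  define \<Phi> where "\<Phi> = (\<lambda>f. \<Prod>\<zeta>\<in>T. norm (\<kappa> \<zeta> f) powr c \<zeta>)"
  have "continuous_on UNIV \<Phi>"
    unfolding \<Phi>_def using \<kappa> by (intro continuous_on_prod_powr) (auto simp: T_def)
  then have closed: "closed {f. \<Phi> f = 1}"
    by (intro closed_Collect_eq) auto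
  have "torus_orbit H F \<subseteq> {f. \<Phi> f = 1}"
  proof
    fix f assume "f \<in> torus_orbit H F"
    then obtain t where t: "t \<in> H" "f = diag_act t F" by (auto simp: torus_orbit_def)
    with H obtain w where w: "t = (\<lambda>j. exp (w j))" "(\<Sum>j\<in>J. w j * complex_of_real (p j)) = 0"
      by blast
    have "\<Phi> f = (\<Prod>\<zeta>\<in>T. norm (exp (\<Sum>j\<in>J. w j * of_int (\<zeta> j))) powr c \<zeta>)"
      unfolding \<Phi>_def t w diag_act_exp[OF assms(1) G] by (intro prod.cong) (auto simp: \<kappa>(2))
    also have "\<dots> = 1" using finT assms(1) w by (intro prod_exp_powr) (auto simp: pj)
    finally show "f \<in> {f. \<Phi> f = 1}" by simp
  qed
  with closed have sub: "closure (torus_orbit H F) \<subseteq> {f. \<Phi> f = 1}" by (rule closure_minimal[rotated])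
  have "(\<lambda>M. \<Sum>\<zeta> | G \<zeta> \<noteq> 0. 0 * G \<zeta> M) = (0 :: ('r, 'a) linear_forms \<Rightarrow> complex)"
    by (auto simp: fun_eq_iff)
  then have "\<kappa> \<xi> 0 = 0" if "\<xi> \<in> T" for \<xi> using \<kappa>(2)[OF that, of "\<lambda>_. 0"] by simp
  then have "\<Phi> 0 = 0" using \<open>T \<noteq> {}\<close> finT by (auto simp: \<Phi>_def)
  then show "0 \<notin> closure (torus_orbit H F)" using sub by auto
qed

section \<open>Common denominators; compact and closed sets of functions\<close>

lemma rational_common_denominator:
  assumes "finite X" "X \<subseteq> \<rat>"
  obtains D :: nat where "D > 0" "\<And>x :: real. x \<in> X \<Longrightarrow> real D * x \<in> \<int>"
proof -
  have "\<exists>D>0. \<forall>x\<in>X. real D * x \<in> \<int>"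
    using assms
  proof (induction X)
    case empty
    then show ?case by (intro exI[of _ 1]) auto
  next
    case (insert x X)
    then obtain D where D: "D > 0" "\<forall>x\<in>X. real D * x \<in> \<int>" by auto
    from insert.prems obtain a b :: int where ab: "b > 0" "x = of_int a / of_int b"
      by (metis Rats_cases' insert_subset)
    have "real (D * nat b) * y \<in> \<int>" if "y \<in> insert x X" for y
    proof (cases "y = x")
      case True
      then have "real (D * nat b) * y = of_int (int D * a)" using ab by simp
      then show ?thesis by (metis Ints_of_int)
    next
      case False
      then have "real D * y \<in> \<int>" using D that by auto
      then have "of_int b * (real D * y) \<in> \<int>" by (rule Ints_mult[OF Ints_of_int])
      moreover have "real (D * nat b) * y = of_int b * (real D * y)" using ab by simp
      ultimately show ?thesis by (simp only:)
    qed
    then show ?case using D ab by (intro exI[of _ "D * nat b"]) auto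
  qed
  then show ?thesis using that by blast
qed

text \<open>Tychonoff's theorem, so the index type may be infinite.\<close>

lemma compact_fun_box:
  fixes A :: "'a \<Rightarrow> 'b::topological_space set"
  assumes "\<And>j. compact (A j)"
  shows "compact {r. \<forall>j. r j \<in> A j}"
proof -
  have "compactin (product_topology (\<lambda>_. euclidean) UNIV) (PiE UNIV A)"
    using assms by (subst compactin_PiE) auto
  then show ?thesis by (simp add: euclidean_product_topology PiE_UNIV_domain Pi_def)
qed

lemma compact_fun_imp_closed:
  fixes K :: "('a \<Rightarrow> 'b::metric_space) set"
  assumes "compact K"
  shows "closed K"
proof -
  have "Hausdorff_space (product_topology (\<lambda>_::'a. euclidean :: 'b topology) UNIV)"
    by (simp add: Hausdorff_space_product_topology)
  then have "Hausdorff_space (euclidean :: ('a \<Rightarrow> 'b) topology)"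
    by (simp add: euclidean_product_topology)
  then show ?thesis
    using assms compactin_imp_closedin[of euclidean K] by simp
qed

text \<open>A linear projection onto L may be discontinuous on the whole function space. On vectors
  supported in S it coincides with the finite sum q, whose coordinates are continuous, and L
  consists of the vectors supported in S that q fixes.\<close>

lemma closed_subspace_finite_support:
  fixes L :: "('i \<Rightarrow> real) set"
  assumes L: "subspace L" and "finite S" and supp: "\<And>v i. v \<in> L \<Longrightarrow> i \<notin> S \<Longrightarrow> v i = 0"
  shows "closed L"
proof -
  obtain p :: "('i \<Rightarrow> real) \<Rightarrow> 'i \<Rightarrow> real"
    where p: "range p \<subseteq> L" "linear p" "\<And>v. v \<in> L \<Longrightarrow> p v = v"
    using real_vector.linear_exists_left_inverse_on[OF linear_id L] by auto
  let ?\<delta> = "\<lambda>s i. if i = s then 1 else 0 :: real"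
  define q where "q = (\<lambda>v. \<Sum>s\<in>S. v s *\<^sub>R p (?\<delta> s))"
  have pq: "p v = q v" if "\<And>i. i \<notin> S \<Longrightarrow> v i = 0" for v
  proof -
    have "v = (\<Sum>s\<in>S. v s *\<^sub>R ?\<delta> s)"
      using that \<open>finite S\<close> by (auto simp: fun_eq_iff sum_fun_apply scaleR_fun_def if_distrib cong: if_cong)
    then have "p v = p (\<Sum>s\<in>S. v s *\<^sub>R ?\<delta> s)" by simp
    also have "\<dots> = q v" unfolding q_def by (simp add: linear_sum[OF p(2)] linear_scale[OF p(2)])
    finally show ?thesis .
  qed
  have "L = {v. (\<forall>i. i \<notin> S \<longrightarrow> v i = 0) \<and> (\<forall>i. v i = (\<Sum>s\<in>S. v s * p (?\<delta> s) i))}" (is "_ = ?R")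
  proof (intro set_eqI iffI)
    fix v assume v: "v \<in> L"
    then have "v = q v" using pq[of v] p(3) supp by auto
    then have "v i = q v i" for i by (rule fun_cong)
    then have "v i = (\<Sum>s\<in>S. v s * p (?\<delta> s) i)" for i
      unfolding q_def sum_fun_apply scaleR_fun_def real_scaleR_def .
    then show "v \<in> ?R" using supp v by blast
  next
    fix v assume v: "v \<in> ?R"
    then have "v i = (\<Sum>s\<in>S. v s * p (?\<delta> s) i)" for i by blast
    then have "q v i = v i" for i
      unfolding q_def sum_fun_apply scaleR_fun_def real_scaleR_def by (rule sym)
    then have "q v = v" by (rule ext)
    moreover have "p v = q v" using v by (intro pq) blast
    ultimately have "p v = v" by (rule trans[rotated])
    then show "v \<in> L" using p(1) by (metis range_subsetD)
  qed
  also have "closed \<dots>"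
    by (intro closed_Collect_conj closed_Collect_all closed_Collect_imp closed_Collect_eq open_Collect_const
        continuous_on_sum continuous_on_mult continuous_on_const continuous_on_product_coordinates)
  finally show ?thesis .
qed

text \<open>Moving from \<open>p\<close> a little away from the barycentre of \<open>S\<close> stays in the hull.\<close>

lemma rel_interior_convex_hull_weights:
  fixes S :: "('a \<Rightarrow> int) set"
  assumes "finite S" and p: "p \<in> rel_interior (convex hull ((\<lambda>\<xi> j. real_of_int (\<xi> j)) ` S))"
  obtains c where "\<And>\<zeta>. \<zeta> \<in> S \<Longrightarrow> 0 < c \<zeta>" "sum c S = 1"
    "\<And>j. p j = (\<Sum>\<zeta>\<in>S. c \<zeta> * real_of_int (\<zeta> j))"
proof -
  let ?emb = "\<lambda>\<xi> j. real_of_int (\<xi> j)"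
  let ?C = "convex hull (?emb ` S)"
  obtain T where T: "openin (top_of_set (affine hull ?C)) T" "p \<in> T" "T \<subseteq> ?C"
    using p unfolding rel_interior_def by blast
  then obtain U where U: "open U" "T = affine hull ?C \<inter> U" by (auto simp: openin_open)
  have "S \<noteq> {}" using T by auto
  define n where "n = real (card S)"
  have n: "n > 0" using \<open>S \<noteq> {}\<close> \<open>finite S\<close> by (simp add: n_def card_gt_0_iff)
  define q where "q = (\<Sum>\<zeta>\<in>S. (1 / n) *\<^sub>R ?emb \<zeta>)"
  have q: "q \<in> ?C"
    unfolding q_def using n \<open>finite S\<close>
    by (intro convex_sum) (auto simp: n_def hull_inc)
  define \<gamma> where "\<gamma> = (\<lambda>\<epsilon>::real. (1 + \<epsilon>) *\<^sub>R p + (- \<epsilon>) *\<^sub>R q)"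
  have aff: "\<gamma> \<epsilon> \<in> affine hull ?C" for \<epsilon>
    unfolding \<gamma>_def using T U q hull_subset[of ?C affine]
    by (intro mem_affine affine_affine_hull) auto
  have "continuous_on UNIV \<gamma>"
    unfolding \<gamma>_def
    by (intro continuous_on_coordinatewise_then_product)
      (auto simp: scaleR_fun_def intro!: continuous_intros)
  then have "open (\<gamma> -` U)" using U(1) by (simp add: open_vimage)
  moreover have "0 \<in> \<gamma> -` U" using T U by (simp add: \<gamma>_def)
  ultimately obtain e where e: "e > 0" "ball 0 e \<subseteq> \<gamma> -` U"
    by (meson openE)
  define \<epsilon> where "\<epsilon> = e / 2"
  have \<epsilon>: "\<epsilon> > 0" "\<gamma> \<epsilon> \<in> U" using e by (auto simp: \<epsilon>_def dist_norm subset_eq)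
  then have "\<gamma> \<epsilon> \<in> ?C" using aff U T by auto
  then obtain c where c: "\<And>\<zeta>. \<zeta> \<in> S \<Longrightarrow> 0 \<le> c \<zeta>" "sum c S = 1"
    "\<And>j. \<gamma> \<epsilon> j = (\<Sum>\<zeta>\<in>S. c \<zeta> * real_of_int (\<zeta> j))"
    using convex_hull_weights[OF \<open>finite S\<close>] by blast
  show ?thesis
  \<comment> \<open>Solving the definition of \<gamma> for p gives
    \<open>p = (\<gamma> \<epsilon> + \<epsilon> q) / (1 + \<epsilon>)\<close>. The barycentre q
    adds \<epsilon> / n to each coefficient, and this makes all of them positive.\<close>
  proof (rule that[of "\<lambda>\<zeta>. (c \<zeta> + \<epsilon> / n) / (1 + \<epsilon>)"])
    show "0 < (c \<zeta> + \<epsilon> / n) / (1 + \<epsilon>)" if "\<zeta> \<in> S" for \<zeta>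
      using c(1)[OF that] \<epsilon> n by (intro divide_pos_pos add_nonneg_pos) auto
    show "(\<Sum>\<zeta>\<in>S. (c \<zeta> + \<epsilon> / n) / (1 + \<epsilon>)) = 1"
      using c(2) \<epsilon> n by (simp add: sum_divide_distrib[symmetric] sum.distrib n_def)
    fix j
    have "(1 + \<epsilon>) * p j - \<epsilon> * q j = (\<Sum>\<zeta>\<in>S. c \<zeta> * real_of_int (\<zeta> j))"
      using c(3)[of j] by (simp add: \<gamma>_def scaleR_fun_def)
    moreover have "\<epsilon> * q j = (\<Sum>\<zeta>\<in>S. \<epsilon> / n * real_of_int (\<zeta> j))"
      by (simp add: q_def sum_fun_apply scaleR_fun_def sum_distrib_left)
    ultimately have "(1 + \<epsilon>) * p j = (\<Sum>\<zeta>\<in>S. (c \<zeta> + \<epsilon> / n) * real_of_int (\<zeta> j))"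
      by (simp add: distrib_right sum.distrib)
    moreover have "p j = (1 + \<epsilon>) * p j / (1 + \<epsilon>)" using \<epsilon> by simp
    ultimately show "p j = (\<Sum>\<zeta>\<in>S. (c \<zeta> + \<epsilon> / n) / (1 + \<epsilon>) * real_of_int (\<zeta> j))"
      by (simp add: sum_divide_distrib)
  qed
qed

section \<open>Closed orbits of the relative torus\<close>

definition orthogonal_directions :: "'a set \<Rightarrow> ('a \<Rightarrow> real) \<Rightarrow> ('a \<Rightarrow> real) set" where
  "orthogonal_directions J b =
    {x. (\<forall>j. j \<notin> J \<longrightarrow> x j = 0) \<and> (\<Sum>j\<in>J. x j) = 0 \<and> (\<Sum>j\<in>J. x j * b j) = 0}"

text \<open>
  Pairing with \<open>\<zeta>\<close> on this space is pairing with the orthogonal projection \<open>m \<zeta>\<close> of \<open>\<zeta>\<close>.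
  The projection is rational if \<open>b\<close> is. So the vector of phases is periodic in each coordinate, and
  a compact box of directions already gives all of them.
\<close>

lemma compact_phases:
  fixes S :: "('a \<Rightarrow> int) set" and b :: "'a \<Rightarrow> real"
  assumes "finite J" "finite S" and rat: "\<And>j. j \<in> J \<Longrightarrow> b j \<in> \<rat>" and b0: "(\<Sum>j\<in>J. b j) = 0"
  shows "compact ((\<lambda>x \<zeta>. if \<zeta> \<in> S then cis (\<Sum>j\<in>J. x j * of_int (\<zeta> j)) else 0)
    ` orthogonal_directions J b)"
proof -
  define n where "n = real (card J)"
  define N where "N = (\<Sum>j\<in>J. b j * b j)"
  define s where "s = (\<lambda>y. (\<Sum>k\<in>J. y k) / n)"
  define t where "t = (\<lambda>y. (\<Sum>k\<in>J. y k * b k) / N)"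
  \<comment> \<open>The projection onto the complement of the constant vector and b, which are
    orthogonal to each other by \<open>b0\<close>. If J is empty or b vanishes on J, division by
    zero returns 0 and the corresponding term drops out.\<close>
  define P where "P = (\<lambda>y j. if j \<in> J then y j - s y - t y * b j else 0)"
  have n_s: "n * s y = (\<Sum>k\<in>J. y k)" for y
    using assms(1) by (cases "J = {}") (auto simp: n_def s_def)
  have N_t: "N * t y = (\<Sum>k\<in>J. y k * b k)" for y
  proof (cases "N = 0")
    case True
    then have "b j = 0" if "j \<in> J" for j
      using that assms(1) by (simp add: N_def sum_nonneg_eq_0_iff)
    then show ?thesis using True by simp
  qed (simp add: t_def)
  have P_mult: "(\<Sum>j\<in>J. P y j * z j) = (\<Sum>j\<in>J. y j * z j) - s y * (n * s z) - t y * (N * t z)" for y z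
  proof -
    have "(\<Sum>j\<in>J. P y j * z j) = (\<Sum>j\<in>J. y j * z j - s y * z j - t y * (z j * b j))"
      by (intro sum.cong) (auto simp: P_def algebra_simps)
    then show ?thesis by (simp add: sum_subtractf n_s N_t sum_distrib_left)
  qed
  have P: "P y \<in> orthogonal_directions J b" for y
  proof -
    have "(\<Sum>j\<in>J. P y j * 1) = (\<Sum>j\<in>J. y j) - s y * n"
      unfolding P_mult n_s N_t by (simp add: b0 n_def)
    moreover have "(\<Sum>j\<in>J. P y j * b j) = (\<Sum>j\<in>J. y j * b j) - t y * N"
      unfolding P_mult n_s N_t by (simp add: b0 N_def)
    ultimately have "(\<Sum>j\<in>J. P y j) = 0" "(\<Sum>j\<in>J. P y j * b j) = 0"
      using n_s[of y] N_t[of y] by (simp_all add: mult.commute)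
    then show ?thesis by (simp add: orthogonal_directions_def P_def)
  qed
  define m where "m = (\<lambda>\<zeta> :: 'a \<Rightarrow> int. P (\<lambda>j. of_int (\<zeta> j)))"
  have self_adjoint: "(\<Sum>j\<in>J. P y j * of_int (\<zeta> j)) = (\<Sum>j\<in>J. y j * m \<zeta> j)" for y \<zeta>
    using P_mult[of y "\<lambda>j. of_int (\<zeta> j)"] P_mult[of "\<lambda>j. of_int (\<zeta> j)" y]
    by (simp add: m_def mult_ac)
  have "m \<zeta> j \<in> \<rat>" if "j \<in> J" for \<zeta> j
    unfolding m_def P_def s_def t_def n_def N_def using that rat
    by (auto intro!: Rats_diff Rats_mult Rats_divide Rats_sum)
  then have "(\<lambda>(\<zeta>, j). m \<zeta> j) ` (S \<times> J) \<subseteq> \<rat>" by auto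
  moreover have "finite ((\<lambda>(\<zeta>, j). m \<zeta> j) ` (S \<times> J))" using assms(1,2) by simp
  ultimately obtain D :: nat
    where D: "D > 0" "\<And>x. x \<in> (\<lambda>(\<zeta>, j). m \<zeta> j) ` (S \<times> J) \<Longrightarrow> real D * x \<in> \<int>"
    using rational_common_denominator by metis
  have Dm: "real D * m \<zeta> j \<in> \<int>" if "\<zeta> \<in> S" "j \<in> J" for \<zeta> j
    using that by (intro D(2)) auto
  have Px: "(\<Sum>j\<in>J. x j * m \<zeta> j) = (\<Sum>j\<in>J. x j * of_int (\<zeta> j))"
    if "x \<in> orthogonal_directions J b" for x \<zeta>
  proof -
    have "P x j = x j" if "j \<in> J" for j
      using that \<open>x \<in> _\<close> by (simp add: P_def s_def t_def orthogonal_directions_def)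
    then show ?thesis unfolding self_adjoint[symmetric] by simp
  qed
  define \<Psi> where "\<Psi> = (\<lambda>r \<zeta>. if \<zeta> \<in> S then cis (\<Sum>j\<in>J. r j * m \<zeta> j) else 0)"
  \<comment> \<open>Since D clears the denominators of \<open>m \<zeta>\<close>, moving a coordinate
    by 2 pi D changes the angle by a multiple of 2 pi. Points of the box need not be orthogonal
    directions; by self-adjointness P turns them into such directions with the same phases.\<close>
  define B where "B = {r :: 'a \<Rightarrow> real. \<forall>j. r j \<in> {0 .. 2 * pi * real D}}"
  have "(\<lambda>x \<zeta>. if \<zeta> \<in> S then cis (\<Sum>j\<in>J. x j * of_int (\<zeta> j)) else 0) ` orthogonal_directions J b
      = \<Psi> ` B" (is "?A = _")
  proof (intro set_eqI iffI)
    fix k assume "k \<in> ?A"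
    then obtain x where x: "x \<in> orthogonal_directions J b"
        "k = (\<lambda>\<zeta>. if \<zeta> \<in> S then cis (\<Sum>j\<in>J. x j * of_int (\<zeta> j)) else 0)" by blast
    define d where "d = 2 * pi * real D"
    have d: "d > 0" using D by (simp add: d_def)
    define r where "r = (\<lambda>j. x j - d * of_int \<lfloor>x j / d\<rfloor>)"
    have "r \<in> B"
      unfolding B_def
    proof (intro CollectI allI)
      fix j
      have "d * of_int \<lfloor>x j / d\<rfloor> \<le> x j" "x j \<le> d * (of_int \<lfloor>x j / d\<rfloor> + 1)"
        using floor_divide_lower[OF d, of "x j"] floor_divide_upper[OF d, of "x j"]
        by (simp_all add: mult.commute)
      then show "r j \<in> {0..2 * pi * real D}" unfolding d_def[symmetric] by (simp add: r_def algebra_simps)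
    qed
    moreover have "k = \<Psi> r"
    proof
      fix \<zeta>
      have "cis (\<Sum>j\<in>J. x j * m \<zeta> j) = cis (\<Sum>j\<in>J. r j * m \<zeta> j)" if "\<zeta> \<in> S"
      proof -
        define z where "z = (\<Sum>j\<in>J. of_int \<lfloor>x j / d\<rfloor> * (real D * m \<zeta> j))"
        have z: "z \<in> \<int>" unfolding z_def using that by (intro Ints_sum Ints_mult[OF Ints_of_int] Dm) auto
        have "(\<Sum>j\<in>J. x j * m \<zeta> j) = (\<Sum>j\<in>J. r j * m \<zeta> j) + 2 * pi * z"
          unfolding z_def sum_distrib_left sum.distrib[symmetric]
          by (intro sum.cong) (auto simp: r_def d_def algebra_simps)
        then show ?thesis using z by (simp add: cis_mult[symmetric])
      qed
      then show "k \<zeta> = \<Psi> r \<zeta>" using Px[OF x(1)] by (simp add: \<Psi>_def x(2))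
    qed
    ultimately show "k \<in> \<Psi> ` B" by blast
  next
    fix k assume "k \<in> \<Psi> ` B"
    then obtain r where "k = \<Psi> r" by blast
    then have "k = (\<lambda>\<zeta>. if \<zeta> \<in> S then cis (\<Sum>j\<in>J. P r j * of_int (\<zeta> j)) else 0)"
      unfolding \<Psi>_def self_adjoint .
    then show "k \<in> ?A" using P by blast
  qed
  moreover have "compact (\<Psi> ` B)"
  proof (rule compact_continuous_image)
    show "compact B" unfolding B_def by (intro compact_fun_box) auto
    show "continuous_on B \<Psi>"
      unfolding \<Psi>_def
    proof (rule continuous_on_coordinatewise_then_product)
      fix \<zeta>
      show "continuous_on B (\<lambda>r. if \<zeta> \<in> S then cis (\<Sum>j\<in>J. r j * m \<zeta> j) else 0)"
        by (cases "\<zeta> \<in> S")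
          (auto intro!: continuous_on_cis continuous_on_sum continuous_on_mult continuous_on_const
            continuous_on_subset[OF continuous_on_product_coordinates])
    qed
  qed
  ultimately show ?thesis by simp
qed

lemma closed_log_moduli:
  fixes S :: "('a \<Rightarrow> int) set"
  assumes "finite S"
  shows "closed ((\<lambda>x \<zeta>. if \<zeta> \<in> S then \<Sum>j\<in>J. x j * of_int (\<zeta> j) else 0 :: real)
    ` orthogonal_directions J b)"
proof (rule closed_subspace_finite_support[OF _ assms])
  have sub: "subspace (orthogonal_directions J b)"
    by (auto simp: subspace_def orthogonal_directions_def scaleR_fun_def sum.distrib distrib_right
        sum_distrib_left[symmetric] mult.assoc)
  have lin: "linear (\<lambda>x \<zeta>. if \<zeta> \<in> S then \<Sum>j\<in>J. x j * of_int (\<zeta> j) else 0 :: real)"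
    by (rule linearI) (auto simp: fun_eq_iff scaleR_fun_def sum.distrib distrib_right
        sum_distrib_left mult.assoc)
  show "subspace ((\<lambda>x \<zeta>. if \<zeta> \<in> S then \<Sum>j\<in>J. x j * of_int (\<zeta> j) else 0 :: real)
    ` orthogonal_directions J b)"
    by (rule linear_subspace_image[OF lin sub])
qed auto

text \<open>
  The coefficients of the points of the orbit have the form \<open>exp (\<Sum> x \<zeta>) * cis (\<Sum> y \<zeta>)\<close>
  where \<open>x\<close> and \<open>y\<close> vary independently. All weights enter the constant product with
  positive exponents, so no coefficient of a point of the closure vanishes.
\<close>

lemma stable_if_rel_interior_orthogonal:
  fixes F :: "('r::finite, 'a) linear_forms \<Rightarrow> complex" and b :: "'a \<Rightarrow> real"
  assumes "finite J" and p: "p \<in> rel_interior (weight_polytope J V F)"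
    and rat: "\<And>j. j \<in> J \<Longrightarrow> b j \<in> \<rat>" and b0: "(\<Sum>j\<in>J. b j) = 0"
    and H: "\<And>w. w \<in> sl_torus_lie J \<Longrightarrow> trace_form J w (\<lambda>j. complex_of_real (b j)) = 0 \<Longrightarrow>
      (\<Sum>j\<in>J. w j * complex_of_real (p j)) = 0"
  shows "stable (relative_torus J (\<lambda>j. complex_of_real (b j))) F"
  unfolding stable_def
proof
  have pW: "p \<in> weight_polytope J V F" using p rel_interior_subset by blast
  show "F \<noteq> 0" using weight_polytope_nonzero assms(1) pW .
  obtain G where G: "weight_decomposition J V F G"
    using weight_polytope_nonempty_decomposition pW .
  let ?S = "{\<zeta>. G \<zeta> \<noteq> 0}"
  have fin: "finite ?S" using G by (simp add: weight_decomposition_def)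
  obtain c where c: "\<And>\<zeta>. \<zeta> \<in> ?S \<Longrightarrow> 0 < c \<zeta>" "sum c ?S = 1"
    "\<And>j. p j = (\<Sum>\<zeta>\<in>?S. c \<zeta> * real_of_int (\<zeta> j))"
    using rel_interior_convex_hull_weights[OF fin p[unfolded weight_polytope_eq[OF assms(1) G]]] by blast
  obtain \<kappa> where \<kappa>: "\<And>\<xi>. G \<xi> \<noteq> 0 \<Longrightarrow> continuous_on UNIV (\<kappa> \<xi>)"
      "\<And>\<xi> c. G \<xi> \<noteq> 0 \<Longrightarrow> \<kappa> \<xi> (\<lambda>M. \<Sum>\<zeta> | G \<zeta> \<noteq> 0. c \<zeta> * G \<zeta> M) = c \<xi>"
    using weight_coefficients_continuous[OF assms(1) G] by blast
  \<comment> \<open>For f outside the span of the components the numbers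
    \<open>\<kappa> \<zeta> f\<close> do not determine f. The second condition, closed as well,
    confines Z to the span.\<close>
  define Z where "Z = {f. (\<Prod>\<zeta>\<in>?S. norm (\<kappa> \<zeta> f) powr c \<zeta>) = 1 \<and>
    (\<forall>M. f M = (\<Sum>\<zeta>\<in>?S. \<kappa> \<zeta> f * G \<zeta> M))}"
  have Z0: "\<kappa> \<zeta> f \<noteq> 0" if "f \<in> Z" "G \<zeta> \<noteq> 0" for f \<zeta>
  proof
    assume "\<kappa> \<zeta> f = 0"
    then have "(\<Prod>\<zeta>\<in>?S. norm (\<kappa> \<zeta> f) powr c \<zeta>) = 0"
      using that fin by (intro prod_zero) auto
    then show False using that by (simp add: Z_def)
  qed
  have "continuous_on UNIV (\<lambda>f. \<Prod>\<zeta>\<in>?S. norm (\<kappa> \<zeta> f) powr c \<zeta>)"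
    using \<kappa> c by (intro continuous_on_prod_powr) auto
  moreover have "continuous_on UNIV (\<lambda>f. \<Sum>\<zeta>\<in>?S. \<kappa> \<zeta> f * G \<zeta> M)" for M
    using \<kappa> by (intro continuous_on_sum continuous_on_mult continuous_on_const) auto
  ultimately have "closed Z"
    unfolding Z_def
    by (intro closed_Collect_conj closed_Collect_all closed_Collect_eq continuous_on_const
        continuous_on_product_coordinates)
  define W where "W = orthogonal_directions J b"
  define L where "L = (\<lambda>x \<zeta>. if \<zeta> \<in> ?S then \<Sum>j\<in>J. x j * of_int (\<zeta> j) else 0 :: real) ` W"
  define U where "U = (\<lambda>x \<zeta>. if \<zeta> \<in> ?S then cis (\<Sum>j\<in>J. x j * of_int (\<zeta> j)) else 0) ` W"
  \<comment> \<open>On Z no coefficient vanishes, so logarithmic moduli and phases are continuous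
    there, and preimages of closed sets are closed because Z is.\<close>
  define md where "md = (\<lambda>f \<zeta>. if \<zeta> \<in> ?S then ln (norm (\<kappa> \<zeta> f)) else 0)"
  define ph where "ph = (\<lambda>f \<zeta>. if \<zeta> \<in> ?S then sgn (\<kappa> \<zeta> f) else 0)"
  have LU: "closed L" "closed U"
    unfolding L_def U_def W_def
    using closed_log_moduli[OF fin] compact_phases[OF assms(1) fin rat b0]
    by (auto intro: compact_fun_imp_closed)
  have "continuous_on Z md"
    unfolding md_def
  proof (rule continuous_on_coordinatewise_then_product)
    fix \<zeta>
    show "continuous_on Z (\<lambda>f. if \<zeta> \<in> ?S then ln (norm (\<kappa> \<zeta> f)) else 0)"
      using Z0 \<kappa>(1)[of \<zeta>]
      by (cases "\<zeta> \<in> ?S") (auto intro!: continuous_on_ln continuous_on_norm intro: continuous_on_subset)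
  qed
  moreover have "continuous_on Z ph"
    unfolding ph_def
  proof (rule continuous_on_coordinatewise_then_product)
    fix \<zeta>
    show "continuous_on Z (\<lambda>f. if \<zeta> \<in> ?S then sgn (\<kappa> \<zeta> f) else 0)"
      using Z0 \<kappa>(1)[of \<zeta>]
      by (cases "\<zeta> \<in> ?S") (auto intro!: continuous_on_sgn intro: continuous_on_subset)
  qed
  ultimately have "closed ((Z \<inter> md -` L) \<inter> (Z \<inter> ph -` U))"
    using \<open>closed Z\<close> LU by (intro closed_Int continuous_closed_preimage)
  also have "(Z \<inter> md -` L) \<inter> (Z \<inter> ph -` U)
      = torus_orbit (relative_torus J (\<lambda>j. complex_of_real (b j))) F" (is "?R = ?O")
  proof (intro set_eqI iffI)
    fix f assume "f \<in> ?O"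
    then obtain w where w: "w \<in> sl_torus_lie J" "trace_form J w (\<lambda>j. complex_of_real (b j)) = 0"
        and f: "f = diag_act (\<lambda>j. exp (w j)) F"
      by (auto simp: torus_orbit_def relative_torus_def)
    have \<kappa>f: "\<kappa> \<zeta> f = exp (\<Sum>j\<in>J. w j * of_int (\<zeta> j))" if "G \<zeta> \<noteq> 0" for \<zeta>
      unfolding f diag_act_exp[OF assms(1) G] using that by (rule \<kappa>(2))
    have Re: "(\<lambda>j. Re (w j)) \<in> W"
    proof -
      have "Re (\<Sum>j\<in>J. w j) = 0" "Re (\<Sum>j\<in>J. w j * complex_of_real (b j)) = 0"
        using w by (simp_all add: sl_torus_lie_def trace_form_def)
      then show ?thesis using w by (auto simp: W_def orthogonal_directions_def sl_torus_lie_def)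
    qed
    have Im: "(\<lambda>j. Im (w j)) \<in> W"
    proof -
      have "Im (\<Sum>j\<in>J. w j) = 0" "Im (\<Sum>j\<in>J. w j * complex_of_real (b j)) = 0"
        using w by (simp_all add: sl_torus_lie_def trace_form_def)
      then show ?thesis using w by (auto simp: W_def orthogonal_directions_def sl_torus_lie_def)
    qed
    have "md f = (\<lambda>\<zeta>. if \<zeta> \<in> ?S then \<Sum>j\<in>J. Re (w j) * of_int (\<zeta> j) else 0)"
      by (auto simp: md_def fun_eq_iff \<kappa>f norm_exp_eq_Re)
    then have "md f \<in> L" unfolding L_def
      using Re by (intro image_eqI[where x = "\<lambda>j. Re (w j)"])
    moreover have "ph f = (\<lambda>\<zeta>. if \<zeta> \<in> ?S then cis (\<Sum>j\<in>J. Im (w j) * of_int (\<zeta> j)) else 0)"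
      by (auto simp: ph_def fun_eq_iff \<kappa>f exp_eq_polar sgn_mult sgn_of_real)
    then have "ph f \<in> U" unfolding U_def
      using Im by (intro image_eqI[where x = "\<lambda>j. Im (w j)"])
    moreover have "f \<in> Z"
    proof -
      have "(\<Prod>\<zeta>\<in>?S. norm (\<kappa> \<zeta> f) powr c \<zeta>)
          = (\<Prod>\<zeta>\<in>?S. norm (exp (\<Sum>j\<in>J. w j * of_int (\<zeta> j))) powr c \<zeta>)"
        by (intro prod.cong) (auto simp: \<kappa>f)
      also have "\<dots> = 1" using fin assms(1) H[OF w] by (intro prod_exp_powr) (auto simp: c(3))
      finally have "(\<Prod>\<zeta>\<in>?S. norm (\<kappa> \<zeta> f) powr c \<zeta>) = 1" .
      moreover have "f M = (\<Sum>\<zeta>\<in>?S. \<kappa> \<zeta> f * G \<zeta> M)" for M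
        unfolding fun_cong[OF trans[OF f diag_act_exp[OF assms(1) G]], of M]
        by (intro sum.cong) (auto simp: \<kappa>f)
      ultimately show ?thesis unfolding Z_def by blast
    qed
    ultimately show "f \<in> ?R" by auto
  next
    fix f assume "f \<in> ?R"
    then have f: "f \<in> Z" "md f \<in> L" "ph f \<in> U" by auto
    then obtain x y where x: "x \<in> W" "md f = (\<lambda>\<zeta>. if \<zeta> \<in> ?S then \<Sum>j\<in>J. x j * of_int (\<zeta> j) else 0)"
      and y: "y \<in> W" "ph f = (\<lambda>\<zeta>. if \<zeta> \<in> ?S then cis (\<Sum>j\<in>J. y j * of_int (\<zeta> j)) else 0)"
      unfolding L_def U_def by blast
    define w where "w = (\<lambda>j. Complex (x j) (y j))"
    have \<kappa>f: "\<kappa> \<zeta> f = exp (\<Sum>j\<in>J. w j * of_int (\<zeta> j))" if "G \<zeta> \<noteq> 0" for \<zeta>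
    proof -
      have "ln (norm (\<kappa> \<zeta> f)) = (\<Sum>j\<in>J. x j * of_int (\<zeta> j))"
        using fun_cong[OF x(2), of \<zeta>] that by (simp add: md_def)
      then have n: "norm (\<kappa> \<zeta> f) = exp (\<Sum>j\<in>J. x j * of_int (\<zeta> j))"
        using Z0[OF f(1) that] by (metis exp_ln norm_eq_zero norm_ge_zero order_le_imp_less_or_eq)
      have s: "sgn (\<kappa> \<zeta> f) = cis (\<Sum>j\<in>J. y j * of_int (\<zeta> j))"
        using fun_cong[OF y(2), of \<zeta>] that by (simp add: ph_def)
      have "\<kappa> \<zeta> f = of_real (norm (\<kappa> \<zeta> f)) * sgn (\<kappa> \<zeta> f)"
        using Z0[OF f(1) that] by (simp add: sgn_div_norm scaleR_conv_of_real)
      also have "\<dots> = exp (\<Sum>j\<in>J. w j * of_int (\<zeta> j))"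
        unfolding n s by (simp add: exp_eq_polar w_def)
      finally show ?thesis .
    qed
    have "f = diag_act (\<lambda>j. exp (w j)) F"
      using f(1) unfolding Z_def diag_act_exp[OF assms(1) G] by (auto simp: fun_eq_iff \<kappa>f)
    moreover have "w \<in> sl_torus_lie J"
      using x(1) y(1) by (auto simp: w_def W_def orthogonal_directions_def sl_torus_lie_def complex_eq_iff)
    moreover have "trace_form J w (\<lambda>j. complex_of_real (b j)) = 0"
      using x(1) y(1) by (auto simp: w_def W_def orthogonal_directions_def trace_form_def complex_eq_iff)
    ultimately show "f \<in> ?O" unfolding torus_orbit_def relative_torus_def by blast
  qed
  finally show "closed ?O" .
qed

section \<open>Integrals over rational polytopes\<close>

definition rat_affine :: "'i set \<Rightarrow> (('i \<Rightarrow> real) \<Rightarrow> real) \<Rightarrow> bool" where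
  "rat_affine I \<alpha> \<longleftrightarrow> (\<exists>c a. c \<in> \<rat> \<and> (\<forall>i\<in>I. a i \<in> \<rat>) \<and> \<alpha> = (\<lambda>x. c + (\<Sum>i\<in>I. a i * x i)))"

text \<open>The ring generated by rational constants, coordinates and indicators of rational
  half-spaces. No explicit subdivision into pieces is stored. With no variables left, only rational
  values remain, which ends the induction on the dimension.\<close>

inductive rat_piecewise :: "'i set \<Rightarrow> (('i \<Rightarrow> real) \<Rightarrow> real) \<Rightarrow> bool" for I where
  const: "q \<in> \<rat> \<Longrightarrow> rat_piecewise I (\<lambda>_. q)"
| coord: "i \<in> I \<Longrightarrow> rat_piecewise I (\<lambda>x. x i)"
| add: "rat_piecewise I f \<Longrightarrow> rat_piecewise I g \<Longrightarrow> rat_piecewise I (\<lambda>x. f x + g x)"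
| mult: "rat_piecewise I f \<Longrightarrow> rat_piecewise I g \<Longrightarrow> rat_piecewise I (\<lambda>x. f x * g x)"
| nonneg: "rat_affine I \<alpha> \<Longrightarrow> rat_piecewise I (\<lambda>x. if 0 \<le> \<alpha> x then 1 else 0)"

lemma rat_affine_const: "q \<in> \<rat> \<Longrightarrow> rat_affine I (\<lambda>_. q)"
  unfolding rat_affine_def by (intro exI[of _ q] exI[of _ "\<lambda>_. 0"]) auto

lemma rat_affine_add:
  assumes "rat_affine I \<alpha>" "rat_affine I \<beta>"
  shows "rat_affine I (\<lambda>x. \<alpha> x + \<beta> x)"
proof -
  from assms obtain c a d b where "c \<in> \<rat>" "\<forall>i\<in>I. a i \<in> \<rat>" "\<alpha> = (\<lambda>x. c + (\<Sum>i\<in>I. a i * x i))"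
    "d \<in> \<rat>" "\<forall>i\<in>I. b i \<in> \<rat>" "\<beta> = (\<lambda>x. d + (\<Sum>i\<in>I. b i * x i))"
    unfolding rat_affine_def by blast
  then show ?thesis unfolding rat_affine_def
    by (intro exI[of _ "c + d"] exI[of _ "\<lambda>i. a i + b i"]) (auto simp: sum.distrib algebra_simps)
qed

lemma rat_affine_scale:
  assumes "rat_affine I \<alpha>" "q \<in> \<rat>"
  shows "rat_affine I (\<lambda>x. q * \<alpha> x)"
proof -
  from assms obtain c a where "c \<in> \<rat>" "\<forall>i\<in>I. a i \<in> \<rat>" "\<alpha> = (\<lambda>x. c + (\<Sum>i\<in>I. a i * x i))"
    unfolding rat_affine_def by blast
  then show ?thesis unfolding rat_affine_def using assms(2)
    by (intro exI[of _ "q * c"] exI[of _ "\<lambda>i. q * a i"]) (auto simp: sum_distrib_left algebra_simps)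
qed

lemma rat_affine_diff:
  assumes "rat_affine I \<alpha>" "rat_affine I \<beta>"
  shows "rat_affine I (\<lambda>x. \<alpha> x - \<beta> x)"
  using rat_affine_add[OF assms(1) rat_affine_scale[OF assms(2), of "-1"]] by simp

lemma rat_affine_imp_rat_piecewise:
  assumes "finite I" "rat_affine I \<alpha>"
  shows "rat_piecewise I \<alpha>"
proof -
  from assms obtain c a where a: "c \<in> \<rat>" "\<forall>i\<in>I. a i \<in> \<rat>" "\<alpha> = (\<lambda>x. c + (\<Sum>i\<in>I. a i * x i))"
    unfolding rat_affine_def by blast
  have "rat_piecewise I (\<lambda>x. \<Sum>i\<in>K. a i * x i)" if "finite K" "K \<subseteq> I" for K
    using that
  proof (induction K)
    case empty
    show ?case using rat_piecewise.const[of 0] by simp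
  next
    case (insert i K)
    then have "rat_piecewise I (\<lambda>x. a i * x i + (\<Sum>i\<in>K. a i * x i))"
      using a by (intro rat_piecewise.intros) auto
    then show ?case using insert by simp
  qed
  then show ?thesis unfolding a(3) using a(1) assms(1) by (intro rat_piecewise.add rat_piecewise.const) auto
qed

lemma rat_piecewise_diff:
  "rat_piecewise I f \<Longrightarrow> rat_piecewise I g \<Longrightarrow> rat_piecewise I (\<lambda>x. f x - g x)"
  using rat_piecewise.add[of I f "\<lambda>x. -1 * g x"] rat_piecewise.mult[of I "\<lambda>_. -1" g]
    rat_piecewise.const[of "-1" I] by simp

lemma rat_piecewise_power: "rat_piecewise I f \<Longrightarrow> rat_piecewise I (\<lambda>x. f x ^ k)"
  by (induction k) (auto intro: rat_piecewise.intros)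

lemma rat_piecewise_prod:
  "(\<And>s. s \<in> S \<Longrightarrow> rat_piecewise I (f s)) \<Longrightarrow> rat_piecewise I (\<lambda>x. \<Prod>s\<in>S. f s x)"
  by (induction S rule: infinite_finite_induct) (auto intro: rat_piecewise.intros)

text \<open>A normal form in the variable t that is to be integrated out: monomials on half lines
  starting at \<beta> x, with coefficients from the ring in the other variables.\<close>

inductive rat_steps :: "'i set \<Rightarrow> (('i \<Rightarrow> real) \<Rightarrow> real \<Rightarrow> real) \<Rightarrow> bool" for I where
  zero: "rat_steps I (\<lambda>_ _. 0)"
| step: "rat_steps I F \<Longrightarrow> rat_piecewise I g \<Longrightarrow> rat_affine I \<beta> \<Longrightarrow>
    rat_steps I (\<lambda>x t. F x t + g x * (t ^ k * (if \<beta> x \<le> t then 1 else 0)))"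

lemma rat_steps_add: "rat_steps I G \<Longrightarrow> rat_steps I F \<Longrightarrow> rat_steps I (\<lambda>x t. F x t + G x t)"
proof (induction rule: rat_steps.induct)
  case (step G g \<beta> k)
  from rat_steps.step[OF step.IH[OF step.prems] step.hyps(2,3), of k]
  show ?case by (simp add: add.assoc)
qed simp

lemma rat_steps_single:
  "rat_piecewise I g \<Longrightarrow> rat_affine I \<beta> \<Longrightarrow>
    rat_steps I (\<lambda>x t. g x * (t ^ k * (if \<beta> x \<le> t then 1 else 0)))"
  using rat_steps.step[OF rat_steps.zero, of I g \<beta> k] by simp

text \<open>Two half lines meet in the one that starts at the larger of \<beta> x and \<beta>' x.
  Which one is larger is decided by the half-space indicator \<open>?c\<close>, so each product
  splits into two terms.\<close>

lemma rat_steps_mult_single: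
  assumes "rat_steps I F" and g: "rat_piecewise I g" and \<beta>: "rat_affine I \<beta>"
  shows "rat_steps I (\<lambda>x t. F x t * (g x * (t ^ k * (if \<beta> x \<le> t then 1 else 0))))"
  using assms(1)
proof (induction rule: rat_steps.induct)
  case zero
  show ?case using rat_steps.zero by simp
next
  case (step F g' \<beta>' k')
  let ?c = "\<lambda>x. if 0 \<le> \<beta> x - \<beta>' x then 1 else 0 :: real"
  let ?s = "\<lambda>x t. g x * g' x * ?c x * (t ^ (k + k') * (if \<beta> x \<le> t then 1 else 0))"
  let ?s' = "\<lambda>x t. g x * g' x * (1 - ?c x) * (t ^ (k + k') * (if \<beta>' x \<le> t then 1 else 0))"
  have c: "rat_piecewise I ?c" by (intro rat_piecewise.nonneg rat_affine_diff \<beta> step.hyps)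
  then have "rat_steps I ?s" "rat_steps I ?s'"
    using g step.hyps \<beta>
    by (auto intro!: rat_steps_single rat_piecewise.mult rat_piecewise_diff rat_piecewise.const)
  from rat_steps_add[OF this(2) rat_steps_add[OF this(1) step.IH]]
  have "rat_steps I (\<lambda>x t. F x t * (g x * (t ^ k * (if \<beta> x \<le> t then 1 else 0))) + ?s x t + ?s' x t)" .
  also have "(\<lambda>x t. F x t * (g x * (t ^ k * (if \<beta> x \<le> t then 1 else 0))) + ?s x t + ?s' x t)
      = (\<lambda>x t. (F x t + g' x * (t ^ k' * (if \<beta>' x \<le> t then 1 else 0)))
          * (g x * (t ^ k * (if \<beta> x \<le> t then 1 else 0))))"
    by (auto simp: fun_eq_iff power_add algebra_simps)
  finally show ?case .
qed

lemma rat_steps_mult: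
  assumes "rat_steps I G" "rat_steps I F"
  shows "rat_steps I (\<lambda>x t. F x t * G x t)"
  using assms(1)
proof (induction rule: rat_steps.induct)
  case zero
  show ?case using rat_steps.zero by simp
next
  case (step G g \<beta> k)
  from rat_steps_add[OF rat_steps_mult_single[OF assms(2) step.hyps(2,3), of k] step.IH]
  show ?case by (simp add: distrib_left)
qed

text \<open>
  An upper bound \<open>t \<le> \<beta> x\<close> is the complement of a lower bound up to the wall \<open>t = \<beta> x\<close>, hence
  the finite exceptional sets.
\<close>

lemma rat_piecewise_eq_rat_steps:
  assumes "finite I" "i \<notin> I" and f: "rat_piecewise (insert i I) f"
  shows "\<exists>F. rat_steps I F \<and> (\<forall>x. finite {t. - real N \<le> t \<and> f (x(i := t)) \<noteq> F x t})"
  using f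
proof (induction rule: rat_piecewise.induct)
  case (const q)
  \<comment> \<open>A function constant in t is not supported on a half line. It agrees with one
    starting at -N where t \<ge> -N, and later only [-N, N] is integrated over.\<close>
  have "rat_steps I (\<lambda>x t. q * (t ^ 0 * (if - real N \<le> t then 1 else 0)))"
    using const by (intro rat_steps_single rat_piecewise.const rat_affine_const) auto
  then show ?case by (intro exI conjI allI) (assumption, auto)
next
  case (coord j)
  show ?case
  proof (cases "j = i")
    case True
    have "rat_steps I (\<lambda>x t. 1 * (t ^ 1 * (if - real N \<le> t then 1 else 0)))"
      by (intro rat_steps_single rat_piecewise.const rat_affine_const) auto
    then show ?thesis using True by (intro exI conjI allI) (assumption, auto)
  next
    case False
    have "rat_steps I (\<lambda>x t. x j * (t ^ 0 * (if - real N \<le> t then 1 else 0)))"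
      using False coord by (intro rat_steps_single rat_piecewise.coord rat_affine_const) auto
    then show ?thesis using False by (intro exI conjI allI) (assumption, auto)
  qed
next
  case (add f g)
  then obtain F G where F: "rat_steps I F" "\<And>x. finite {t. - real N \<le> t \<and> f (x(i := t)) \<noteq> F x t}"
    and G: "rat_steps I G" "\<And>x. finite {t. - real N \<le> t \<and> g (x(i := t)) \<noteq> G x t}" by blast
  have "finite {t. - real N \<le> t \<and> f (x(i := t)) + g (x(i := t)) \<noteq> F x t + G x t}" for x
    by (rule finite_subset[OF _ finite_UnI[OF F(2)[of x] G(2)[of x]]]) auto
  then show ?case using rat_steps_add[OF G(1) F(1)] by blast
next
  case (mult f g)
  then obtain F G where F: "rat_steps I F" "\<And>x. finite {t. - real N \<le> t \<and> f (x(i := t)) \<noteq> F x t}"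
    and G: "rat_steps I G" "\<And>x. finite {t. - real N \<le> t \<and> g (x(i := t)) \<noteq> G x t}" by blast
  have "finite {t. - real N \<le> t \<and> f (x(i := t)) * g (x(i := t)) \<noteq> F x t * G x t}" for x
    by (rule finite_subset[OF _ finite_UnI[OF F(2)[of x] G(2)[of x]]]) auto
  then show ?case using rat_steps_mult[OF G(1) F(1)] by blast
next
  case (nonneg \<alpha>)
  then obtain c a where a: "c \<in> \<rat>" "\<forall>j\<in>insert i I. a j \<in> \<rat>" "\<alpha> = (\<lambda>x. c + (\<Sum>j\<in>insert i I. a j * x j))"
    unfolding rat_affine_def by blast
  define \<alpha>' where "\<alpha>' = (\<lambda>x. c + (\<Sum>j\<in>I. a j * x j))"
  have \<alpha>': "rat_affine I \<alpha>'" unfolding \<alpha>'_def rat_affine_def using a by blast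
  have \<alpha>: "\<alpha> (x(i := t)) = a i * t + \<alpha>' x" for x t
  proof -
    have "(\<Sum>j\<in>I. a j * (x(i := t)) j) = (\<Sum>j\<in>I. a j * x j)"
      using assms(2) by (intro sum.cong) auto
    then show ?thesis using assms by (simp add: a(3) \<alpha>'_def)
  qed
  consider "a i = 0" | "a i > 0" | "a i < 0" by linarith
  then show ?case
  proof cases
    case 1
    have "rat_steps I (\<lambda>x t. (if 0 \<le> \<alpha>' x then 1 else 0) * (t ^ 0 * (if - real N \<le> t then 1 else 0)))"
      by (intro rat_steps_single rat_piecewise.nonneg \<alpha>' rat_affine_const) auto
    moreover have "finite {t. - real N \<le> t \<and> (if 0 \<le> \<alpha> (x(i := t)) then 1 else 0)
        \<noteq> (if 0 \<le> \<alpha>' x then 1 else 0) * (t ^ 0 * (if - real N \<le> t then 1 else 0))}" for x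
    proof -
      have "0 \<le> \<alpha> (x(i := t)) \<longleftrightarrow> 0 \<le> \<alpha>' x" for t using 1 by (simp add: \<alpha>)
      then show ?thesis by (simp del: fun_upd_apply)
    qed
    ultimately show ?thesis by (intro exI conjI allI)
  next
    case 2
    define \<beta> where "\<beta> = (\<lambda>x. (- 1 / a i) * \<alpha>' x)"
    have "rat_affine I \<beta>" unfolding \<beta>_def using a by (intro rat_affine_scale \<alpha>') auto
    then have "rat_steps I (\<lambda>x t. 1 * (t ^ 0 * (if \<beta> x \<le> t then 1 else 0)))"
      by (intro rat_steps_single rat_piecewise.const) auto
    moreover have "\<alpha> (x(i := t)) = a i * (t - \<beta> x)" for x t
      using 2 by (simp add: \<alpha> \<beta>_def algebra_simps)
    then have "0 \<le> \<alpha> (x(i := t)) \<longleftrightarrow> \<beta> x \<le> t" for x t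
      using 2 by (simp add: zero_le_mult_iff del: fun_upd_apply)
    then have "finite {t. - real N \<le> t \<and> (if 0 \<le> \<alpha> (x(i := t)) then 1 else 0)
        \<noteq> 1 * (t ^ 0 * (if \<beta> x \<le> t then 1 else 0))}" for x
      by (simp del: fun_upd_apply)
    ultimately show ?thesis by (intro exI conjI allI)
  next
    case 3
    define \<beta> where "\<beta> = (\<lambda>x. (- 1 / a i) * \<alpha>' x)"
    have "rat_affine I \<beta>" unfolding \<beta>_def using a by (intro rat_affine_scale \<alpha>') auto
    then have "rat_steps I (\<lambda>x t. 1 * (t ^ 0 * (if - real N \<le> t then 1 else 0))
        + (-1) * (t ^ 0 * (if \<beta> x \<le> t then 1 else 0)))"
      by (intro rat_steps_add rat_steps_single rat_piecewise.const rat_affine_const) auto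
    moreover have "finite {t. - real N \<le> t \<and> (if 0 \<le> \<alpha> (x(i := t)) then 1 else 0)
        \<noteq> 1 * (t ^ 0 * (if - real N \<le> t then 1 else 0)) + (-1) * (t ^ 0 * (if \<beta> x \<le> t then 1 else 0))}" for x
    proof (rule finite_subset[of _ "{\<beta> x}"])
      have "\<alpha> (x(i := t)) = a i * (t - \<beta> x)" for t
        using 3 by (simp add: \<alpha> \<beta>_def algebra_simps)
      then have "0 \<le> \<alpha> (x(i := t)) \<longleftrightarrow> t \<le> \<beta> x" for t
        using 3 by (simp add: zero_le_mult_iff del: fun_upd_apply)
      then show "{t. - real N \<le> t \<and> (if 0 \<le> \<alpha> (x(i := t)) then 1 else 0)
        \<noteq> 1 * (t ^ 0 * (if - real N \<le> t then 1 else 0)) + (-1) * (t ^ 0 * (if \<beta> x \<le> t then 1 else 0))}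
        \<subseteq> {\<beta> x}" by auto
    qed auto
    ultimately show ?thesis by (intro exI conjI allI)
  qed
qed

text \<open>The antiderivative of t^k gives a difference of powers of N and of the maximum of
  \<beta> x and -N; this maximum is again piecewise rational. Integrability is carried along because
  additivity of the integral needs it.\<close>

lemma rat_steps_integral:
  assumes "finite I" "rat_steps I F"
  shows "(\<forall>x. integrable lborel (\<lambda>t. indicator {- real N..real N} t * F x t)) \<and>
    rat_piecewise I (\<lambda>x. \<integral>t. indicator {- real N..real N} t * F x t \<partial>lborel)"
  using assms(2)
proof (induction rule: rat_steps.induct)
  case zero
  show ?case using rat_piecewise.const[of 0 I] by simp
next
  case (step F g \<beta> k)
  let ?M = "\<lambda>x. max (\<beta> x) (- real N)"
  let ?s = "\<lambda>x t. g x * (t ^ k * (if \<beta> x \<le> t then 1 else 0))"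
  have eq: "indicator {- real N..real N} t * ?s x t = g x * (t ^ k * indicator {?M x..real N} t)" for x t
    by (auto simp: indicator_def)
  have int: "integrable lborel (\<lambda>t. t ^ k * indicator {?M x..real N} t)" for x
    using borel_integrable_atLeastAtMost'[OF continuous_on_power[OF continuous_on_id], of "?M x" "real N" k]
    by (simp add: set_integrable_def mult.commute)
  \<comment> \<open>The indicator handles \<beta> x > N, where the interval is empty and the
    difference of powers would be wrong.\<close>
  let ?v = "\<lambda>x. (if 0 \<le> real N - \<beta> x then 1 else 0) * (1 / Suc k * (real N ^ Suc k - ?M x ^ Suc k))"
  have val: "(\<integral>t. t ^ k * indicator {?M x..real N} t \<partial>lborel) = ?v x" for x
  proof (cases "\<beta> x \<le> real N")
    case True
    then show ?thesis by (subst integral_power) auto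
  qed auto
  have "?M = (\<lambda>x. (if 0 \<le> \<beta> x - (- real N) then 1 else 0) * \<beta> x
      + (1 - (if 0 \<le> \<beta> x - (- real N) then 1 else 0)) * (- real N))"
    by (auto simp: fun_eq_iff max_def)
  moreover have "rat_piecewise I \<dots>"
    using step.hyps assms(1)
    by (intro rat_piecewise.intros rat_piecewise_diff rat_affine_diff rat_affine_const
        rat_affine_imp_rat_piecewise) auto
  ultimately have M: "rat_piecewise I ?M" by (simp only:)
  have v: "rat_piecewise I ?v"
    using step.hyps M
    by (intro rat_piecewise.intros rat_piecewise_diff rat_piecewise_power rat_affine_diff rat_affine_const)
      auto
  have ints: "integrable lborel (\<lambda>t. indicator {- real N..real N} t * ?s x t)" for x
    unfolding eq using int by simp
  have "(\<integral>t. indicator {- real N..real N} t * (F x t + ?s x t) \<partial>lborel)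
      = (\<integral>t. indicator {- real N..real N} t * F x t \<partial>lborel) + g x * ?v x" for x
  proof -
    have "(\<integral>t. indicator {- real N..real N} t * ?s x t \<partial>lborel) = g x * ?v x"
      unfolding eq by (simp only: integral_mult_right_zero val)
    then show ?thesis using step.IH ints[of x] by (simp only: distrib_left Bochner_Integration.integral_add)
  qed
  then have sum: "(\<lambda>x. \<integral>t. indicator {- real N..real N} t * (F x t + ?s x t) \<partial>lborel)
      = (\<lambda>x. (\<integral>t. indicator {- real N..real N} t * F x t \<partial>lborel) + g x * ?v x)"
    by (rule ext)
  show ?case
  proof (intro conjI allI)
    show "integrable lborel (\<lambda>t. indicator {- real N..real N} t * (F x t + ?s x t))" for x
      using step.IH ints[of x] by (simp add: distrib_left)
    show "rat_piecewise I (\<lambda>x. \<integral>t. indicator {- real N..real N} t * (F x t + ?s x t) \<partial>lborel)"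
      unfolding sum by (intro rat_piecewise.add rat_piecewise.mult conjunct2[OF step.IH] step.hyps v)
  qed
qed

section \<open>Iterated integration over boxes\<close>

lemma rat_piecewise_measurable_PiM:
  "rat_piecewise I f \<Longrightarrow> f \<in> borel_measurable (PiM I (\<lambda>_. lborel))"
proof (induction rule: rat_piecewise.induct)
  case (nonneg \<alpha>)
  then obtain c a where \<alpha>: "\<alpha> = (\<lambda>x. c + (\<Sum>i\<in>I. a i * x i))" unfolding rat_affine_def by blast
  have "\<alpha> \<in> borel_measurable (PiM I (\<lambda>_. lborel))" unfolding \<alpha> by measurable
  then show ?case by measurable
qed (auto intro: borel_measurable_add borel_measurable_times measurable_component_singleton)

lemma rat_piecewise_measurable_update:
  "rat_piecewise I f \<Longrightarrow> (\<lambda>t. f (x(i := t))) \<in> borel_measurable borel"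
proof (induction rule: rat_piecewise.induct)
  case (coord j)
  then show ?case by (cases "j = i") auto
next
  case (nonneg \<alpha>)
  then obtain c a where \<alpha>: "\<alpha> = (\<lambda>x. c + (\<Sum>i\<in>I. a i * x i))" unfolding rat_affine_def by blast
  have "(\<lambda>t. (x(i := t)) j) \<in> borel_measurable borel" for j by (cases "j = i") auto
  then have "(\<lambda>t. \<alpha> (x(i := t))) \<in> borel_measurable borel" unfolding \<alpha> by measurable
  then show ?case by measurable
qed auto

lemma rat_piecewise_bounded:
  "rat_piecewise I f \<Longrightarrow> \<exists>C. \<forall>x. (\<forall>i\<in>I. \<bar>x i\<bar> \<le> real N) \<longrightarrow> \<bar>f x\<bar> \<le> C"
proof (induction rule: rat_piecewise.induct)
  case (add f g)
  then obtain C D where "\<forall>x. (\<forall>i\<in>I. \<bar>x i\<bar> \<le> real N) \<longrightarrow> \<bar>f x\<bar> \<le> C"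
    "\<forall>x. (\<forall>i\<in>I. \<bar>x i\<bar> \<le> real N) \<longrightarrow> \<bar>g x\<bar> \<le> D" by blast
  then show ?case by (intro exI[of _ "C + D"]) (smt (verit, best))
next
  case (mult f g)
  then obtain C D where "\<forall>x. (\<forall>i\<in>I. \<bar>x i\<bar> \<le> real N) \<longrightarrow> \<bar>f x\<bar> \<le> C"
    "\<forall>x. (\<forall>i\<in>I. \<bar>x i\<bar> \<le> real N) \<longrightarrow> \<bar>g x\<bar> \<le> D" by blast
  then show ?case
    by (intro exI[of _ "C * D"]) (auto simp: abs_mult intro!: mult_mono intro: order_trans[OF abs_ge_zero])
qed (auto intro: exI[of _ "real N"] exI[of _ 1])

lemma rat_piecewise_empty: "rat_piecewise {} f \<Longrightarrow> f x \<in> \<rat>"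
  by (induction rule: rat_piecewise.induct) auto

text \<open>On [-N, N] the normal form differs from the integrand at finitely many points only, a
  null set.\<close>

lemma rat_piecewise_slice_integral:
  assumes "finite I" "i \<notin> I" and f: "rat_piecewise (insert i I) f"
  obtains g where "rat_piecewise I g"
    "\<And>x. (\<integral>t. indicator {- real N..real N} t * f (x(i := t)) \<partial>lborel) = g x"
proof -
  obtain F where F: "rat_steps I F" "\<And>x. finite {t. - real N \<le> t \<and> f (x(i := t)) \<noteq> F x t}"
    using rat_piecewise_eq_rat_steps[OF assms] by blast
  note int = rat_steps_integral[OF assms(1) F(1), of N]
  show ?thesis
  proof (rule that)
    show "rat_piecewise I (\<lambda>x. \<integral>t. indicator {- real N..real N} t * F x t \<partial>lborel)"
      using int by blast
    fix x
    show "(\<integral>t. indicator {- real N..real N} t * f (x(i := t)) \<partial>lborel)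
      = (\<integral>t. indicator {- real N..real N} t * F x t \<partial>lborel)"
    proof (rule integral_cong_AE)
      show "(\<lambda>t. indicator {- real N..real N} t * f (x(i := t))) \<in> borel_measurable lborel"
        using rat_piecewise_measurable_update[OF f, of x i] by simp
      show "(\<lambda>t. indicator {- real N..real N} t * F x t) \<in> borel_measurable lborel"
        using int borel_measurable_integrable by blast
      have "AE t in lborel. t \<notin> {t. - real N \<le> t \<and> f (x(i := t)) \<noteq> F x t}"
        by (intro AE_not_in finite_imp_null_set_lborel F)
      then show "AE t in lborel. indicator {- real N..real N} t * f (x(i := t))
          = indicator {- real N..real N} t * F x t"
        by eventually_elim (auto simp: indicator_def)
    qed
  qed
qed

lemma rat_piecewise_box_integrable:
  assumes "finite I" and f: "rat_piecewise I f"
  shows "integrable (PiM I (\<lambda>_. lborel)) (\<lambda>x. (\<Prod>i\<in>I. indicator {- real N..real N} (x i)) * f x)"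
proof -
  interpret product_sigma_finite "\<lambda>_. lborel :: real measure" ..
  obtain C where C: "\<And>x. (\<forall>i\<in>I. \<bar>x i\<bar> \<le> real N) \<Longrightarrow> \<bar>f x\<bar> \<le> C"
    using rat_piecewise_bounded[OF f, of N] by blast
  have "integrable (PiM I (\<lambda>_. lborel)) (\<lambda>x. \<Prod>i\<in>I. indicator {- real N..real N} (x i) :: real)"
    by (intro product_integrable_prod assms(1)) (simp add: integrable_indicator_iff)
  then have 1: "integrable (PiM I (\<lambda>_. lborel)) (\<lambda>x. C * (\<Prod>i\<in>I. indicator {- real N..real N} (x i)))"
    by simp
  show ?thesis
  proof (rule Bochner_Integration.integrable_bound[OF 1])
    show "(\<lambda>x. (\<Prod>i\<in>I. indicator {- real N..real N} (x i)) * f x) \<in> borel_measurable (PiM I (\<lambda>_. lborel))"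
      using rat_piecewise_measurable_PiM[OF f] by measurable
    have "norm ((\<Prod>i\<in>I. indicator {- real N..real N} (x i)) * f x)
        \<le> norm (C * (\<Prod>i\<in>I. indicator {- real N..real N} (x i)))" for x :: "'a \<Rightarrow> real"
    proof (cases "\<forall>i\<in>I. x i \<in> {- real N..real N}")
      case True
      then have "\<bar>f x\<bar> \<le> C" by (intro C) auto
      then show ?thesis using True by simp
    next
      case False
      then have "(\<Prod>i\<in>I. indicator {- real N..real N} (x i)) = (0 :: real)"
        using assms(1) by (intro prod_zero) (auto simp: indicator_def)
      then show ?thesis by simp
    qed
    then show "AE x in PiM I (\<lambda>_. lborel). norm ((\<Prod>i\<in>I. indicator {- real N..real N} (x i)) * f x)
        \<le> norm (C * (\<Prod>i\<in>I. indicator {- real N..real N} (x i)))" by simp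
  qed
qed

text \<open>Fubini with the new variable innermost: the slice integral falls back into the ring with
  one variable fewer. For no variables the product measure is a unit point mass.\<close>

lemma rat_piecewise_box_integral:
  assumes "finite I" "rat_piecewise I f"
  shows "(\<integral>x. (\<Prod>i\<in>I. indicator {- real N..real N} (x i)) * f x \<partial>PiM I (\<lambda>_. lborel)) \<in> \<rat>"
  using assms
proof (induction I arbitrary: f)
  case empty
  interpret product_sigma_finite "\<lambda>_. lborel :: real measure" ..
  show ?case using rat_piecewise_empty[OF empty] by (simp add: PiM_empty lebesgue_integral_count_space_finite)
next
  case (insert i I)
  interpret product_sigma_finite "\<lambda>_. lborel :: real measure" ..
  obtain g where g: "rat_piecewise I g"
    "\<And>x. (\<integral>t. indicator {- real N..real N} t * f (x(i := t)) \<partial>lborel) = g x"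
    using rat_piecewise_slice_integral[OF insert.hyps insert.prems] by blast
  have inner: "(\<integral>t. (\<Prod>j\<in>insert i I. indicator {- real N..real N} ((x(i := t)) j)) * f (x(i := t)) \<partial>lborel)
      = (\<Prod>j\<in>I. indicator {- real N..real N} (x j)) * g x" for x
  proof -
    have "(\<Prod>j\<in>I. indicator {- real N..real N} ((x(i := t)) j) :: real)
        = (\<Prod>j\<in>I. indicator {- real N..real N} (x j))" for t
      using insert.hyps by (intro prod.cong) auto
    then have "(\<Prod>j\<in>insert i I. indicator {- real N..real N} ((x(i := t)) j)) * f (x(i := t))
        = (\<Prod>j\<in>I. indicator {- real N..real N} (x j)) * (indicator {- real N..real N} t * f (x(i := t)))" for t
      using insert.hyps by (simp add: mult_ac)
    then show ?thesis by (simp only: integral_mult_right_zero g(2))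
  qed
  have "finite (insert i I)" using insert.hyps by simp
  from rat_piecewise_box_integrable[OF this insert.prems, of N]
  show ?case
    by (simp only: product_integral_insert[OF insert.hyps] inner insert.IH[OF g(1)])
qed

section \<open>Moments of bounded rational polyhedra\<close>

definition rat_affine_vec :: "(real ^ 'n \<Rightarrow> real) \<Rightarrow> bool" where
  "rat_affine_vec f \<longleftrightarrow> (\<exists>a c. (\<forall>k. a $ k \<in> \<rat>) \<and> c \<in> \<rat> \<and> f = (\<lambda>x. a \<bullet> x + c))"

lemma rat_affine_vec_coordinates:
  assumes "rat_affine_vec f"
  shows "rat_affine Basis (\<lambda>x. f (\<Sum>b\<in>Basis. x b *\<^sub>R b))"
proof -
  obtain a c where a: "\<And>k. a $ k \<in> \<rat>" "c \<in> \<rat>" "f = (\<lambda>x. a \<bullet> x + c)"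
    using assms unfolding rat_affine_vec_def by blast
  have "a \<bullet> b \<in> \<rat>" if "b \<in> Basis" for b
    using that a(1) by (auto simp: Basis_vec_def inner_axis)
  then show ?thesis
    unfolding rat_affine_def a(3) using a(2)
    by (intro exI[of _ c] exI[of _ "\<lambda>b. a \<bullet> b"]) (auto simp: inner_sum_right mult.commute)
qed

lemma rat_affine_vec_measurable: "rat_affine_vec f \<Longrightarrow> f \<in> borel_measurable borel"
  unfolding rat_affine_vec_def by auto

text \<open>A bounded polyhedron lies in some box, so the indicator of the box can be inserted
  without changing the integral. Two affine factors are allowed because the Gram matrix consists of
  second moments.\<close>

lemma rational_polyhedron_integral:
  fixes Fs :: "(real ^ 'n \<Rightarrow> real) set"
  assumes "finite Fs" and Fs: "\<And>f. f \<in> Fs \<Longrightarrow> rat_affine_vec f"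
    and bounded: "bounded {x. \<forall>f\<in>Fs. 0 \<le> f x}" and g: "rat_affine_vec g" and h: "rat_affine_vec h"
  shows "(LINT x : {x. \<forall>f\<in>Fs. 0 \<le> f x} | lborel. g x * h x) \<in> \<rat>"
proof -
  let ?P = "{x. \<forall>f\<in>Fs. 0 \<le> f x}"
  let ?e = "\<lambda>x. \<Sum>b\<in>Basis. x b *\<^sub>R b :: real ^ 'n"
  obtain B where B: "\<And>x. x \<in> ?P \<Longrightarrow> norm x \<le> B" using bounded unfolding bounded_iff by blast
  obtain N :: nat where N: "B \<le> real N" using real_arch_simple by blast
  define u where "u = (\<lambda>x. (\<Prod>f\<in>Fs. if 0 \<le> f (?e x) then 1 else 0) * (g (?e x) * h (?e x)))"
  have u: "rat_piecewise Basis u"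
    unfolding u_def using Fs g h
    by (intro rat_piecewise.mult rat_piecewise_prod rat_piecewise.nonneg rat_affine_imp_rat_piecewise
        rat_affine_vec_coordinates) auto
  have P: "?P \<in> sets borel"
  proof -
    have "{x \<in> space borel. \<forall>f\<in>Fs. 0 \<le> f x} \<in> sets borel"
      using assms(1) Fs
      by (intro sets.sets_Collect_finite_All borel_measurable_le borel_measurable_const
          rat_affine_vec_measurable) auto
    then show ?thesis by simp
  qed
  have "(LINT x : ?P | lborel. g x * h x)
      = (\<integral>x. indicator ?P (?e x) *\<^sub>R (g (?e x) * h (?e x)) \<partial>PiM Basis (\<lambda>_. lborel))"
    unfolding set_lebesgue_integral_def
  proof (subst (1) lborel_eq, subst integral_distr)
    show "?e \<in> PiM Basis (\<lambda>_. lborel) \<rightarrow>\<^sub>M borel" by measurable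
    show "(\<lambda>x. indicator ?P x *\<^sub>R (g x * h x)) \<in> borel_measurable borel"
      using P rat_affine_vec_measurable[OF g] rat_affine_vec_measurable[OF h] by simp
  qed simp
  also have "\<dots> = (\<integral>x. (\<Prod>b\<in>Basis. indicator {- real N..real N} (x b)) * u x \<partial>PiM Basis (\<lambda>_. lborel))"
  proof (rule Bochner_Integration.integral_cong[OF refl])
    fix x :: "real ^ 'n \<Rightarrow> real"
    show "indicator ?P (?e x) *\<^sub>R (g (?e x) * h (?e x))
        = (\<Prod>b\<in>Basis. indicator {- real N..real N} (x b)) * u x"
    proof (cases "?e x \<in> ?P")
      case True
      have "x b \<in> {- real N..real N}" if "b \<in> Basis" for b
      proof -
        have "\<bar>x b\<bar> \<le> norm (?e x)" using Basis_le_norm[OF that, of "?e x"] that by simp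
        then show ?thesis using B[OF True] N by auto
      qed
      then show ?thesis using True by (simp add: u_def)
    next
      case False
      then have "(\<Prod>f\<in>Fs. if 0 \<le> f (?e x) then 1 else 0 :: real) = 0"
        using assms(1) by (intro prod_zero) auto
      then show ?thesis using False by (simp add: u_def)
    qed
  qed
  also have "\<dots> \<in> \<rat>" by (rule rat_piecewise_box_integral[OF finite_Basis u])
  finally show ?thesis .
qed

section \<open>The lattice-normalised surface measure\<close>

text \<open>Cauchy's functional equation. Additivity and nonnegativity make h monotone, so h (n t)
  is squeezed between m h 1 and (m + 1) h 1 for m the floor of n t. The error h 1 does not grow with
  n, whereas n |h t - t h 1| does.\<close>

lemma additive_nonneg_imp_linear:
  fixes h :: "real \<Rightarrow> real"
  assumes add: "\<And>s t. 0 \<le> s \<Longrightarrow> 0 \<le> t \<Longrightarrow> h (s + t) = h s + h t"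
    and nonneg: "\<And>t. 0 \<le> t \<Longrightarrow> 0 \<le> h t" and "0 \<le> t"
  shows "h t = t * h 1"
proof (rule ccontr)
  assume ne: "h t \<noteq> t * h 1"
  have mono: "h s \<le> h t" if "0 \<le> s" "s \<le> t" for s t
    using add[of s "t - s"] nonneg[of "t - s"] that by simp
  have h0: "h 0 = 0" using add[of 0 0] by simp
  have mult: "h (real n * t) = real n * h t" if "0 \<le> t" for n t
  proof (induction n)
    case (Suc n)
    have "h (real (Suc n) * t) = h (real n * t + t)" by (simp add: algebra_simps)
    then show ?case using add[of "real n * t" t] that Suc by (simp add: algebra_simps)
  qed (simp add: h0)
  obtain n :: nat where n: "h 1 < real n * \<bar>h t - t * h 1\<bar>"
    using ex_less_of_nat_mult[of "\<bar>h t - t * h 1\<bar>" "h 1"] ne by auto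
  define m where "m = nat \<lfloor>real n * t\<rfloor>"
  have nt: "0 \<le> real n * t" using \<open>0 \<le> t\<close> by simp
  then have m: "real m \<le> real n * t" "real n * t \<le> real (Suc m)" unfolding m_def by linarith+
  have "real m * h 1 \<le> real n * h t" "real n * h t \<le> real (Suc m) * h 1"
    using mono[OF _ m(1)] mono[OF nt m(2)] mult[OF \<open>0 \<le> t\<close>, of n] mult[of 1 m] mult[of 1 "Suc m"]
    by simp_all
  moreover have "real m * h 1 \<le> (real n * t) * h 1" "(real n * t) * h 1 \<le> real (Suc m) * h 1"
    using m nonneg[of 1] by (auto intro: mult_right_mono)
  ultimately have "\<bar>real n * h t - (real n * t) * h 1\<bar> \<le> h 1"
    by (simp add: abs_le_iff algebra_simps)
  moreover have "\<bar>real n * h t - (real n * t) * h 1\<bar> = real n * \<bar>h t - t * h 1\<bar>"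
  proof -
    have "real n * h t - (real n * t) * h 1 = real n * (h t - t * h 1)" by (simp add: algebra_simps)
    then show ?thesis by (simp only: abs_mult abs_of_nat)
  qed
  ultimately show False using n by linarith
qed

lemma lborel_integral_translation:
  fixes f :: "'a::euclidean_space \<Rightarrow> real"
  assumes "f \<in> borel_measurable borel"
  shows "(\<integral>x. f (v + x) \<partial>lborel) = (\<integral>x. f x \<partial>lborel)"
proof -
  have "(\<integral>x. f x \<partial>lborel) = (\<integral>x. f x \<partial>distr lborel borel ((+) v))"
    by (simp add: lborel_distr_plus)
  also have "\<dots> = (\<integral>x. f (v + x) \<partial>lborel)" using assms by (subst integral_distr) auto
  finally show ?thesis ..
qed

lemma AE_not_hyperplane:
  fixes p :: "'a::euclidean_space"
  assumes "p \<noteq> 0"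
  shows "AE x in lborel. p \<bullet> x \<noteq> c"
proof -
  have "negligible {x. p \<bullet> x = c}" using assms by (intro negligible_hyperplane) auto
  moreover have "{x. p \<bullet> x = c} \<in> sets borel" by measurable
  ultimately have "{x. p \<bullet> x = c} \<in> null_sets lborel"
    by (simp add: negligible_iff_null_sets null_sets_completion_iff)
  then have "AE x in lborel. x \<notin> {x. p \<bullet> x = c}" by (rule AE_not_in)
  then show ?thesis by simp
qed

definition hyperplane_proj :: "'a::euclidean_space \<Rightarrow> real \<Rightarrow> 'a \<Rightarrow> 'a" where
  "hyperplane_proj p c x = x - ((p \<bullet> x - c) / (p \<bullet> p)) *\<^sub>R p"

lemma hyperplane_proj_translate:
  assumes "p \<noteq> 0"
  shows "hyperplane_proj p c ((s / (p \<bullet> p)) *\<^sub>R p + x) = hyperplane_proj p c x"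
proof -
  have "(p \<bullet> ((s / (p \<bullet> p)) *\<^sub>R p + x) - c) / (p \<bullet> p) = s / (p \<bullet> p) + (p \<bullet> x - c) / (p \<bullet> p)"
    using assms by (simp add: inner_add_right add_divide_distrib diff_divide_distrib)
  then show ?thesis unfolding hyperplane_proj_def by (simp only: scaleR_add_left add_diff_add) simp
qed

lemma hyperplane_proj_measurable [measurable]: "hyperplane_proj p c \<in> borel \<rightarrow>\<^sub>M borel"
  unfolding hyperplane_proj_def by measurable

definition slab :: "'a::euclidean_space \<Rightarrow> real \<Rightarrow> 'a set \<Rightarrow> real \<Rightarrow> 'a set" where
  "slab p c F s = {x. c \<le> p \<bullet> x \<and> p \<bullet> x \<le> c + s \<and> hyperplane_proj p c x \<in> F}"

lemma slab_measurable [measurable]: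
  assumes [measurable]: "F \<in> sets borel"
  shows "slab p c F s \<in> sets borel"
  unfolding slab_def by measurable

lemma bounded_slab:
  fixes p :: "'a::euclidean_space"
  assumes "bounded F"
  shows "bounded (slab p c F s)"
proof -
  obtain B where B: "\<And>x. x \<in> F \<Longrightarrow> norm x \<le> B" using assms unfolding bounded_iff by blast
  have "norm x \<le> B + \<bar>s\<bar> / (p \<bullet> p) * norm p" if "x \<in> slab p c F s" for x
  proof -
    have "norm x \<le> norm (hyperplane_proj p c x) + norm (((p \<bullet> x - c) / (p \<bullet> p)) *\<^sub>R p)"
      unfolding hyperplane_proj_def by (metis diff_add_cancel norm_triangle_ineq)
    moreover have "norm (((p \<bullet> x - c) / (p \<bullet> p)) *\<^sub>R p) \<le> \<bar>s\<bar> / (p \<bullet> p) * norm p"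
      using that by (auto simp: slab_def abs_mult intro!: mult_right_mono divide_right_mono)
    ultimately show ?thesis using B that by (force simp: slab_def)
  qed
  then show ?thesis unfolding bounded_iff by blast
qed

lemma slab_integrable:
  fixes p :: "'a::euclidean_space" and u :: "'a \<Rightarrow> real"
  assumes F: "F \<in> sets borel" "bounded F" and [measurable]: "u \<in> borel_measurable borel"
    and C: "\<And>x. x \<in> F \<Longrightarrow> \<bar>u x\<bar> \<le> C"
  shows "set_integrable lborel (slab p c F s) (\<lambda>x. u (hyperplane_proj p c x))"
  unfolding set_integrable_def
proof (rule integrableI_bounded_set_indicator)
  show "slab p c F s \<in> sets lborel" using F by simp
  show "emeasure lborel (slab p c F s) < \<infinity>" by (intro emeasure_bounded_finite bounded_slab F)
  show "AE x in lborel. x \<in> slab p c F s \<longrightarrow> norm (u (hyperplane_proj p c x)) \<le> C"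
    using C by (auto simp: slab_def)
qed measurable

text \<open>
  The integral over the slab is additive in its thickness, by translation in the direction \<open>p\<close>.
  This avoids computing the determinant of a dilation in that direction.
\<close>

lemma slab_integral_add:
  fixes p :: "'a::euclidean_space" and u :: "'a \<Rightarrow> real"
  assumes "p \<noteq> 0" and F: "F \<in> sets borel" "bounded F" and u: "u \<in> borel_measurable borel"
    and C: "\<And>x. x \<in> F \<Longrightarrow> \<bar>u x\<bar> \<le> C" and "0 \<le> s" "0 \<le> t"
  shows "(LINT x : slab p c F (s + t) | lborel. u (hyperplane_proj p c x))
    = (LINT x : slab p c F s | lborel. u (hyperplane_proj p c x))
      + (LINT x : slab p c F t | lborel. u (hyperplane_proj p c x))"
proof -
  define v where "v = (- s / (p \<bullet> p)) *\<^sub>R p"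
  have v: "p \<bullet> (v + x) = p \<bullet> x - s" "hyperplane_proj p c (v + x) = hyperplane_proj p c x" for x
    using \<open>p \<noteq> 0\<close> hyperplane_proj_translate[OF \<open>p \<noteq> 0\<close>, of c "- s" x]
    by (simp_all add: v_def inner_add_right inner_diff_right)
  let ?f = "\<lambda>t x. indicator (slab p c F t) x *\<^sub>R u (hyperplane_proj p c x)"
  note [measurable] = F(1) u
  have f[measurable]: "?f t \<in> borel_measurable borel" for t by measurable
  have int: "integrable lborel (?f t)" for t
    using slab_integrable[OF F u C, where s = t] by (simp add: set_integrable_def)
  have shift: "?f t (v + x) = (if c + s \<le> p \<bullet> x \<and> p \<bullet> x \<le> c + s + t \<and> hyperplane_proj p c x \<in> F
      then u (hyperplane_proj p c x) else 0)" for x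
    by (auto simp: slab_def v indicator_def)
  have "integrable lborel (\<lambda>x. ?f t (v + x))"
    using int[of t] integrable_distr_eq[of "(+) v" lborel borel "?f t"] by (simp add: lborel_distr_plus)
  moreover have "(\<integral>x. ?f (s + t) x \<partial>lborel) = (\<integral>x. ?f s x + ?f t (v + x) \<partial>lborel)"
  proof (rule integral_cong_AE)
    \<comment> \<open>The slab and the translated slab overlap only in the hyperplane at level c +
      s, which is a null set.\<close>
    show "AE x in lborel. ?f (s + t) x = ?f s x + ?f t (v + x)"
      using AE_not_hyperplane[OF \<open>p \<noteq> 0\<close>, of "c + s"]
      unfolding shift
      by eventually_elim (use \<open>0 \<le> s\<close> \<open>0 \<le> t\<close> in \<open>auto simp: slab_def indicator_def\<close>)
  qed measurable
  ultimately show ?thesis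
    unfolding set_lebesgue_integral_def using int lborel_integral_translation[OF f, of t v] by simp
qed

text \<open>Additivity gives linearity only together with a sign, so u is written as the difference
  of u + |C| and |C|, both nonnegative on F. The modulus is taken because C may be negative when F
  is empty.\<close>

lemma slab_integral_linear:
  fixes p :: "'a::euclidean_space" and u :: "'a \<Rightarrow> real"
  assumes "p \<noteq> 0" and F: "F \<in> sets borel" "bounded F" and u: "u \<in> borel_measurable borel"
    and C: "\<And>x. x \<in> F \<Longrightarrow> \<bar>u x\<bar> \<le> C" and "0 \<le> s"
  shows "(LINT x : slab p c F s | lborel. u (hyperplane_proj p c x))
    = s * (LINT x : slab p c F 1 | lborel. u (hyperplane_proj p c x))"
proof -
  let ?h = "\<lambda>u s. LINT x : slab p c F s | lborel. u (hyperplane_proj p c x)"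
  have nonneg: "?h w s = s * ?h w 1"
    if w: "w \<in> borel_measurable borel" "\<And>x. x \<in> F \<Longrightarrow> 0 \<le> w x \<and> w x \<le> D" for w :: "'a \<Rightarrow> real" and D
  proof (rule additive_nonneg_imp_linear[OF _ _ \<open>0 \<le> s\<close>])
    show "?h w (s + t) = ?h w s + ?h w t" if "0 \<le> s" "0 \<le> t" for s t
      using that w by (intro slab_integral_add[OF \<open>p \<noteq> 0\<close> F w(1), of D]) auto
    show "0 \<le> ?h w t" for t
      unfolding set_lebesgue_integral_def using w
      by (intro Bochner_Integration.integral_nonneg) (auto simp: slab_def indicator_def)
  qed
  have split: "?h u s = ?h (\<lambda>x. u x + \<bar>C\<bar>) s - ?h (\<lambda>x. \<bar>C\<bar>) s" for s
  proof -
    have "set_integrable lborel (slab p c F s) (\<lambda>x. u (hyperplane_proj p c x) + \<bar>C\<bar>)"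
      using slab_integrable[OF F, of "\<lambda>x. u x + \<bar>C\<bar>" "2 * \<bar>C\<bar>" p c s] u C by force
    moreover have "set_integrable lborel (slab p c F s) (\<lambda>x. \<bar>C\<bar>)"
      using slab_integrable[OF F, of "\<lambda>x. \<bar>C\<bar>" "\<bar>C\<bar>" p c s] by simp
    ultimately show ?thesis by (simp flip: set_integral_diff(2))
  qed
  have "?h (\<lambda>x. u x + \<bar>C\<bar>) s = s * ?h (\<lambda>x. u x + \<bar>C\<bar>) 1"
    using u C by (intro nonneg[of _ "2 * \<bar>C\<bar>"]) (auto, (smt (verit, best))+)
  moreover have "?h (\<lambda>x. \<bar>C\<bar>) s = s * ?h (\<lambda>x. \<bar>C\<bar>) 1"
    by (rule nonneg[of _ "\<bar>C\<bar>"]) auto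
  ultimately show ?thesis unfolding split[of s] split[of 1] by (simp add: right_diff_distrib)
qed

text \<open>
  The set \<open>slab p c F s\<close> has thickness \<open>s / norm p\<close>. So the factor \<open>1 / norm p\<close> replaces
  the slab of thickness one by one with rational inequalities.
\<close>

lemma surface_integral_eq_slab_integral:
  fixes p :: "real ^ 'n" and u :: "real ^ 'n \<Rightarrow> real"
  assumes "p \<noteq> 0" and F: "F \<in> sets borel" "bounded F" and u: "u \<in> borel_measurable borel"
    and C: "\<And>x. x \<in> F \<Longrightarrow> \<bar>u x\<bar> \<le> C"
  shows "(LINT x : F | surface_measure p c. u x) / norm p
    = (LINT x : slab p c F 1 | lborel. u (hyperplane_proj p c x))"
proof -
  let ?S = "{x. c \<le> p \<bullet> x \<and> p \<bullet> x \<le> c + norm p}"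
  note [measurable] = F(1) u
  have S: "?S \<in> sets borel" by measurable
  have "(LINT x : F | surface_measure p c. u x)
      = (\<integral>x. indicator F (hyperplane_proj p c x) *\<^sub>R u (hyperplane_proj p c x) \<partial>restrict_space lborel ?S)"
    unfolding set_lebesgue_integral_def surface_measure_def hyperplane_proj_def[symmetric]
  proof (rule integral_distr)
    show "hyperplane_proj p c \<in> restrict_space lborel ?S \<rightarrow>\<^sub>M borel"
      by (rule measurable_restrict_space1) simp
  qed measurable
  also have "\<dots> = (\<integral>x. indicator ?S x *\<^sub>R (indicator F (hyperplane_proj p c x) *\<^sub>R u (hyperplane_proj p c x)) \<partial>lborel)"
    using S by (intro integral_restrict_space) simp
  also have "\<dots> = (LINT x : slab p c F (norm p) | lborel. u (hyperplane_proj p c x))"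
    unfolding set_lebesgue_integral_def
    by (intro Bochner_Integration.integral_cong) (auto simp: slab_def indicator_def)
  also have "\<dots> = norm p * (LINT x : slab p c F 1 | lborel. u (hyperplane_proj p c x))"
    by (rule slab_integral_linear[OF assms]) auto
  finally show ?thesis using \<open>p \<noteq> 0\<close> by simp
qed

section \<open>The potential of the extremal vector field\<close>

text \<open>The type \<open>'n option\<close> supplies n + 1 indices, for the constant and the
  coordinate functions, so that square matrices and determinants over a finite index type
  apply.\<close>

definition affine_basis :: "'n option \<Rightarrow> real ^ 'n \<Rightarrow> real" where
  "affine_basis m x = (case m of None \<Rightarrow> 1 | Some k \<Rightarrow> x $ k)"

definition affine_comb :: "real ^ 'n option \<Rightarrow> real ^ 'n \<Rightarrow> real" where
  "affine_comb a x = (\<Sum>m\<in>UNIV. a $ m * affine_basis m x)"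

lemma affine_comb_eq:
  "affine_comb a x = a $ None + (\<Sum>k\<in>UNIV. a $ Some k * x $ k)"
  by (simp add: affine_comb_def affine_basis_def UNIV_option_conv sum.reindex)

lemma affine_function_iff: "affine_function u \<longleftrightarrow> (\<exists>a. u = affine_comb a)"
proof
  assume "affine_function u"
  then obtain c where lin: "linear (\<lambda>x. u x - c)" unfolding affine_function_def by blast
  define a :: "real ^ 'a option"
    where "a = (\<chi> m. case m of None \<Rightarrow> c | Some k \<Rightarrow> u (axis k 1) - c)"
  have "u x = affine_comb a x" for x
  proof -
    have "u x - c = u (\<Sum>k\<in>UNIV. x $ k *\<^sub>R axis k 1) - c"
      using basis_expansion[of x] by (simp add: scalar_mult_eq_scaleR)
    also have "\<dots> = (\<Sum>k\<in>UNIV. x $ k * (u (axis k 1) - c))"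
      using linear_sum[OF lin, of "\<lambda>k. x $ k *\<^sub>R axis k 1" UNIV]
      by (simp add: linear_scale[OF lin])
    finally show ?thesis by (simp add: affine_comb_eq a_def mult.commute)
  qed
  then show "\<exists>a. u = affine_comb a" by blast
next
  assume "\<exists>a. u = affine_comb a"
  then obtain a where u: "u = affine_comb a" by blast
  have "linear (\<lambda>x. u x - a $ None)"
    by (rule linearI) (simp_all add: u affine_comb_eq algebra_simps sum.distrib sum_distrib_left)
  then show "affine_function u" unfolding affine_function_def by blast
qed

lemma affine_comb_add: "affine_comb a x + affine_comb b x = affine_comb (a + b) x"
  by (simp add: affine_comb_def sum.distrib distrib_right)

lemma affine_comb_const: "affine_comb (axis None c) x = c"
  by (simp add: affine_comb_eq axis_def)

lemma continuous_on_affine_comb: "continuous_on S (affine_comb a)"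
  unfolding affine_comb_eq[abs_def] by (intro continuous_intros)

lemma continuous_on_affine_basis: "continuous_on S (affine_basis m)"
  unfolding affine_basis_def by (cases m) (auto intro!: continuous_intros)

lemma affine_basis_rat: "rat_affine_vec (affine_basis m)"
proof (cases m)
  case None
  then have "affine_basis m = (\<lambda>x. 0 \<bullet> x + 1)" by (simp add: affine_basis_def fun_eq_iff)
  then show ?thesis unfolding rat_affine_vec_def by (intro exI[of _ 0] exI[of _ 1]) auto
next
  case (Some k)
  then have "affine_basis m = (\<lambda>x. axis k 1 \<bullet> x + 0)"
    by (simp add: affine_basis_def fun_eq_iff inner_axis')
  then show ?thesis unfolding rat_affine_vec_def
    by (intro exI[of _ "axis k 1"] exI[of _ 0]) (auto simp: axis_def)
qed

lemma affine_comb_eq_0: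
  assumes "open U" "x0 \<in> U" and 0: "\<And>x. x \<in> U \<Longrightarrow> affine_comb a x = 0"
  shows "a = 0"
proof -
  obtain e where e: "e > 0" "cball x0 e \<subseteq> U" using assms open_contains_cball by blast
  have Some: "a $ Some k = 0" for k
  proof -
    have "x0 + e *\<^sub>R axis k 1 \<in> U" using e by (intro subsetD[OF e(2)]) (simp add: dist_norm)
    moreover have "affine_comb a (x0 + e *\<^sub>R axis k 1) = affine_comb a x0 + a $ Some k * e"
    proof -
      have "(\<Sum>j\<in>UNIV. a $ Some j * (e * axis k 1 $ j)) = (\<Sum>j\<in>UNIV. if j = k then a $ Some k * e else 0)"
        by (intro sum.cong) (auto simp: axis_def)
      then show ?thesis by (simp add: affine_comb_eq distrib_left sum.distrib)
    qed
    ultimately show ?thesis using 0[of x0] 0[of "x0 + e *\<^sub>R axis k 1"] assms(2) e by simp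
  qed
  then have "a $ None = 0" using 0[OF assms(2)] by (simp add: affine_comb_eq)
  then have "a $ m = 0" for m using Some by (cases m) auto
  then show ?thesis by (simp add: vec_eq_iff)
qed

definition gram :: "(real ^ 'n) set \<Rightarrow> real ^ 'n option ^ 'n option" where
  "gram P = (\<chi> k m. LINT x : P | lborel. affine_basis m x * affine_basis k x)"

lemma affine_comb_mult_integral:
  assumes "compact P"
  shows "(LINT x : P | lborel. affine_comb a x * affine_comb b x) = b \<bullet> (gram P *v a)"
proof -
  have int: "set_integrable lborel P (\<lambda>x. a $ m * b $ k * (affine_basis m x * affine_basis k x))" for m k
    unfolding set_integrable_def
    by (intro borel_integrable_compact assms continuous_intros continuous_on_affine_basis)
  have "affine_comb a x * affine_comb b x
      = (\<Sum>k\<in>UNIV. \<Sum>m\<in>UNIV. a $ m * b $ k * (affine_basis m x * affine_basis k x))" for x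
    unfolding affine_comb_def sum_product by (subst sum.swap) (simp add: mult_ac)
  then have "(LINT x : P | lborel. affine_comb a x * affine_comb b x)
      = (LINT x : P | lborel. \<Sum>k\<in>UNIV. \<Sum>m\<in>UNIV. a $ m * b $ k * (affine_basis m x * affine_basis k x))"
    by simp
  also have "\<dots> = (\<Sum>k\<in>UNIV. \<Sum>m\<in>UNIV. LINT x : P | lborel. a $ m * b $ k * (affine_basis m x * affine_basis k x))"
    unfolding set_lebesgue_integral_def scaleR_sum_right
    by (simp only: Bochner_Integration.integral_sum Bochner_Integration.integrable_sum
        int[unfolded set_integrable_def])
  also have "\<dots> = b \<bullet> (gram P *v a)"
    by (simp add: inner_vec_def matrix_vector_mult_def gram_def sum_distrib_left mult_ac)
  finally show ?thesis .
qed

text \<open>A kernel vector is an affine function of zero L^2 norm on P. The part of the interior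
  where it does not vanish is open and null, hence empty, and an affine function vanishing on a
  nonempty open set is zero.\<close>

lemma gram_nonsingular:
  assumes "compact P" "interior P \<noteq> {}"
  shows "det (gram P) \<noteq> 0"
proof -
  have "a = 0" if a: "gram P *v a = 0" for a
  proof -
    have int: "integrable lborel (\<lambda>x. indicator P x *\<^sub>R (affine_comb a x * affine_comb a x))"
      by (intro borel_integrable_compact assms continuous_intros continuous_on_affine_comb)
    have "(LINT x : P | lborel. affine_comb a x * affine_comb a x) = 0"
      using affine_comb_mult_integral[OF assms(1), of a a] a by simp
    then have "AE x in lborel. indicator P x *\<^sub>R (affine_comb a x * affine_comb a x) = 0"
      unfolding set_lebesgue_integral_def using integral_nonneg_eq_0_iff_AE[OF int] by simp
    then have AE: "AE x in lborel. x \<notin> interior P \<inter> {x. affine_comb a x \<noteq> 0}"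
      by eventually_elim (use interior_subset in \<open>auto simp: indicator_def split: if_splits\<close>)
    let ?U = "interior P \<inter> {x. affine_comb a x \<noteq> 0}"
    have U: "open ?U"
      by (intro open_Int open_interior open_Collect_neq continuous_on_affine_comb continuous_intros)
    have "?U \<in> null_sets lborel"
      using AE U by (subst (asm) AE_iff_null_sets[symmetric]) auto
    then have "negligible ?U"
      by (simp add: negligible_iff_null_sets null_sets_completionI)
    then have "?U = {}" using U open_not_negligible by blast
    moreover obtain x0 where "x0 \<in> interior P" using assms(2) by blast
    ultimately show ?thesis by (intro affine_comb_eq_0[OF open_interior]) auto
  qed
  then have "\<exists>B. B ** gram P = mat 1" using matrix_left_invertible_ker by blast
  then show ?thesis using invertible_left_inverse invertible_det_nz by blast
qed

lemma rational_det:
  fixes A :: "real ^ 'm ^ 'm"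
  assumes "\<And>i j. A $ i $ j \<in> \<rat>"
  shows "det A \<in> \<rat>"
  unfolding det_def using assms
  by (intro Rats_sum Rats_mult Rats_of_int) (auto intro: Rats_prod)

lemma rational_linear_system:
  fixes A :: "real ^ 'm ^ 'm"
  assumes "det A \<noteq> 0" "\<And>i j. A $ i $ j \<in> \<rat>" "\<And>i. b $ i \<in> \<rat>" "A *v x = b"
  shows "x $ i \<in> \<rat>"
proof -
  have "x $ i = det (\<chi> k j. if j = i then b $ k else A $ k $ j) / det A"
    using assms(4) cramer[OF assms(1)] by (simp add: vec_eq_iff)
  also have "\<dots> \<in> \<rat>"
    using assms by (intro Rats_divide rational_det) auto
  finally show ?thesis .
qed

lemma inner_rational:
  fixes a b :: "real ^ 'n"
  assumes "\<And>k. a $ k \<in> \<rat>" "\<And>k. b $ k \<in> \<rat>"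
  shows "a \<bullet> b \<in> \<rat>"
  unfolding inner_vec_def using assms by (intro Rats_sum) auto

text \<open>The orthogonal projection divides by \<open>p \<bullet> p\<close> and not by the norm,
  so no square root appears.\<close>

lemma rat_affine_vec_proj:
  assumes "\<And>k. p $ k \<in> \<rat>" "c \<in> \<rat>" "rat_affine_vec f"
  shows "rat_affine_vec (\<lambda>x. f (hyperplane_proj p c x))"
proof -
  obtain a d where a: "\<And>k. a $ k \<in> \<rat>" "d \<in> \<rat>" "f = (\<lambda>x. a \<bullet> x + d)"
    using assms(3) unfolding rat_affine_vec_def by blast
  let ?r = "(a \<bullet> p) / (p \<bullet> p)"
  have r: "?r \<in> \<rat>" using assms a by (intro Rats_divide inner_rational) auto
  have "f (hyperplane_proj p c x) = (a - ?r *\<^sub>R p) \<bullet> x + (d + c * ?r)" for x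
    by (simp add: a(3) hyperplane_proj_def inner_diff_right inner_diff_left algebra_simps diff_divide_distrib)
  moreover have "(a - ?r *\<^sub>R p) $ k \<in> \<rat>" for k
    unfolding vector_minus_component vector_scaleR_component real_scaleR_def
    using a(1) assms(1) r by (intro Rats_diff Rats_mult)
  moreover have "d + c * ?r \<in> \<rat>" by (intro Rats_add Rats_mult a(2) assms(2) r)
  ultimately show ?thesis unfolding rat_affine_vec_def by blast
qed

lemma int_vec_rational: "int_vec w $ k \<in> \<rat>"
  by (simp add: int_vec_def)

lemma int_vec_eq_0: "int_vec w = 0 \<longleftrightarrow> w = 0"
  by (simp add: int_vec_def vec_eq_iff)

section \<open>Rationality of the extremal potential of a Delzant polytope\<close>

locale delzant =
  fixes d :: nat and l :: "nat \<Rightarrow> int ^ 'n" and lam :: "nat \<Rightarrow> int"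
  assumes delzant: "delzant_polytope d l lam"
begin

abbreviation "P \<equiv> polyhedron_of d l lam"

lemma compact_P: "compact P"
  using delzant polytope_imp_compact unfolding delzant_polytope_def by blast

lemma interior_P: "interior P \<noteq> {}"
proof -
  have P: "polytope P" "aff_dim P = int DIM(real ^ 'n)"
    using delzant by (auto simp: delzant_polytope_def)
  then have "P \<noteq> {}" by auto
  then have "rel_interior P \<noteq> {}" using P by (simp add: rel_interior_eq_empty polytope_imp_convex)
  then show ?thesis using interior_rel_interior[OF P(2)] by simp
qed

lemma normal_nonzero: "j \<in> {1..d} \<Longrightarrow> int_vec (l j) \<noteq> 0"
proof
  assume j: "j \<in> {1..d}" and "int_vec (l j) = 0"
  then have "l j = 0" by (simp add: int_vec_eq_0)
  then have "Gcd (range (\<lambda>k. l j $ k)) = 0" by simp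
  moreover have "Gcd (range (\<lambda>k. l j $ k)) = 1" using delzant j unfolding delzant_polytope_def by blast
  ultimately show False by simp
qed

lemma facet_measurable: "facet d l lam j \<in> sets borel"
proof -
  have "facet d l lam j = P \<inter> {x. int_vec (l j) \<bullet> x = real_of_int (lam j)}"
    by (auto simp: facet_def)
  moreover have "closed \<dots>"
    using compact_P by (intro closed_Int compact_imp_closed closed_hyperplane) auto
  ultimately show ?thesis by (simp add: borel_closed)
qed

lemma bounded_facet: "bounded (facet d l lam j)"
  by (rule bounded_subset[OF compact_imp_bounded[OF compact_P]]) (auto simp: facet_def)

abbreviation "facet_slab j \<equiv> slab (int_vec (l j)) (lam j) (facet d l lam j) 1"
abbreviation "facet_proj j \<equiv> hyperplane_proj (int_vec (l j)) (real_of_int (lam j))"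

lemma continuous_bounded_on_facet:
  assumes "continuous_on UNIV u"
  obtains C where "\<And>x. x \<in> facet d l lam j \<Longrightarrow> \<bar>u x :: real\<bar> \<le> C"
proof -
  have "bounded (u ` P)"
    by (intro compact_imp_bounded compact_continuous_image compact_P continuous_on_subset[OF assms]) auto
  then obtain C where "\<And>y. y \<in> u ` P \<Longrightarrow> norm y \<le> C" unfolding bounded_iff by blast
  then show ?thesis using that[of C] by (force simp: facet_def)
qed

lemma boundary_integral_eq:
  assumes "continuous_on UNIV u"
  shows "boundary_integral d l lam u = (\<Sum>j=1..d. LINT x : facet_slab j | lborel. u (facet_proj j x))"
  unfolding boundary_integral_def
proof (intro sum.cong refl)
  fix j assume "j \<in> {1..d}"
  moreover obtain C where "\<And>x. x \<in> facet d l lam j \<Longrightarrow> \<bar>u x\<bar> \<le> C"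
    using continuous_bounded_on_facet[OF assms] by blast
  ultimately show "(LINT x : facet d l lam j | surface_measure (int_vec (l j)) (real_of_int (lam j)). u x)
      / norm (int_vec (l j)) = (LINT x : facet_slab j | lborel. u (facet_proj j x))"
    using assms
    by (intro surface_integral_eq_slab_integral normal_nonzero facet_measurable bounded_facet
        borel_measurable_continuous_onI) auto
qed

definition boundary_moment :: "real ^ 'n option" where
  "boundary_moment = (\<chi> m. boundary_integral d l lam (affine_basis m))"

lemma boundary_integral_affine:
  "boundary_integral d l lam (affine_comb b) = b \<bullet> boundary_moment"
proof -
  have int: "set_integrable lborel (facet_slab j) (\<lambda>x. affine_basis m (facet_proj j x))" for j m
  proof -
    obtain C where "\<And>x. x \<in> facet d l lam j \<Longrightarrow> \<bar>affine_basis m x\<bar> \<le> C"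
      using continuous_bounded_on_facet[OF continuous_on_affine_basis] by blast
    then show ?thesis
      by (intro slab_integrable facet_measurable bounded_facet borel_measurable_continuous_onI
          continuous_on_affine_basis) auto
  qed
  have "(LINT x : facet_slab j | lborel. affine_comb b (facet_proj j x))
      = (\<Sum>m\<in>UNIV. b $ m * (LINT x : facet_slab j | lborel. affine_basis m (facet_proj j x)))" for j
  proof -
    have "(LINT x : facet_slab j | lborel. affine_comb b (facet_proj j x))
        = (\<integral>x. (\<Sum>m\<in>UNIV. b $ m * (indicator (facet_slab j) x *\<^sub>R affine_basis m (facet_proj j x))) \<partial>lborel)"
      unfolding set_lebesgue_integral_def affine_comb_def
      by (intro Bochner_Integration.integral_cong) (auto simp: sum_distrib_left mult_ac)
    also have "\<dots> = (\<Sum>m\<in>UNIV. \<integral>x. b $ m * (indicator (facet_slab j) x *\<^sub>R affine_basis m (facet_proj j x)) \<partial>lborel)"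
      using int[of j] unfolding set_integrable_def
      by (intro Bochner_Integration.integral_sum integrable_mult_right)
    finally show ?thesis unfolding set_lebesgue_integral_def by (simp only: integral_mult_right_zero)
  qed
  then have "boundary_integral d l lam (affine_comb b)
      = (\<Sum>j=1..d. \<Sum>m\<in>UNIV. b $ m * (LINT x : facet_slab j | lborel. affine_basis m (facet_proj j x)))"
    by (simp add: boundary_integral_eq continuous_on_affine_comb)
  also have "\<dots> = (\<Sum>m\<in>UNIV. b $ m * boundary_integral d l lam (affine_basis m))"
    by (subst sum.swap) (simp add: boundary_integral_eq continuous_on_affine_basis sum_distrib_left)
  finally show ?thesis by (simp add: boundary_moment_def inner_vec_def)
qed

lemma rat_affine_vec_int_vec:
  "rat_affine_vec (\<lambda>x. int_vec w \<bullet> x + real_of_int c)" "rat_affine_vec (\<lambda>x. real_of_int c - int_vec w \<bullet> x)"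
proof -
  show "rat_affine_vec (\<lambda>x. int_vec w \<bullet> x + real_of_int c)"
    unfolding rat_affine_vec_def using int_vec_rational Rats_of_int by blast
  have "\<forall>k. (- int_vec w) $ k \<in> \<rat>" by (simp add: int_vec_rational)
  then show "rat_affine_vec (\<lambda>x. real_of_int c - int_vec w \<bullet> x)"
    unfolding rat_affine_vec_def
    by (intro exI[of _ "- int_vec w"] exI[of _ "real_of_int c"]) auto
qed

lemma boundary_moment_rational: "boundary_moment $ m \<in> \<rat>"
proof -
  have "(LINT x : facet_slab j | lborel. affine_basis m (facet_proj j x)) \<in> \<rat>" if j: "j \<in> {1..d}" for j
  proof -
    \<comment> \<open>The first two functions bound the thickness; the others say that the projected
      point lies in P. That it satisfies the facet equation is automatic, since the projection lands
      in the hyperplane.\<close>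
    define Fs where "Fs = {\<lambda>x. int_vec (l j) \<bullet> x + real_of_int (- lam j),
        \<lambda>x. real_of_int (lam j + 1) - int_vec (l j) \<bullet> x}
      \<union> (\<lambda>k x. real_of_int (lam k) - int_vec (l k) \<bullet> facet_proj j x) ` {1..d}"
    have "int_vec (l j) \<bullet> facet_proj j x = real_of_int (lam j)" for x
      using normal_nonzero[OF j] by (simp add: hyperplane_proj_def inner_diff_right)
    then have slab: "facet_slab j = {x. \<forall>f\<in>Fs. 0 \<le> f x}"
      by (auto simp: slab_def Fs_def facet_def polyhedron_of_def)
    \<comment> \<open>The factor \<open>affine_basis None\<close> is the constant 1 and fills the
      second affine slot.\<close>
    have "(LINT x : {x. \<forall>f\<in>Fs. 0 \<le> f x} | lborel. affine_basis None x * affine_basis m (facet_proj j x)) \<in> \<rat>"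
    proof (rule rational_polyhedron_integral)
      show "finite Fs" by (simp add: Fs_def)
      show "rat_affine_vec f" if "f \<in> Fs" for f
        using that rat_affine_vec_int_vec(1)[of "l j" "- lam j"] rat_affine_vec_int_vec(2)[of "lam j + 1" "l j"]
          rat_affine_vec_proj[OF int_vec_rational Rats_of_int rat_affine_vec_int_vec(2)]
        by (auto simp: Fs_def)
      show "bounded {x. \<forall>f\<in>Fs. 0 \<le> f x}"
        unfolding slab[symmetric] by (intro bounded_slab bounded_facet)
      show "rat_affine_vec (\<lambda>x. affine_basis m (facet_proj j x))"
        by (intro rat_affine_vec_proj int_vec_rational Rats_of_int affine_basis_rat)
    qed (rule affine_basis_rat)
    then show ?thesis by (simp add: slab affine_basis_def)
  qed
  then show ?thesis
    unfolding boundary_moment_def vec_lambda_beta boundary_integral_eq[OF continuous_on_affine_basis]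
    by (rule Rats_sum)
qed

lemma gram_rational: "gram P $ k $ m \<in> \<rat>"
proof -
  define Fs where "Fs = (\<lambda>k x. real_of_int (lam k) - int_vec (l k) \<bullet> x) ` {1..d}"
  have P: "P = {x. \<forall>f\<in>Fs. 0 \<le> f x}" by (auto simp: Fs_def polyhedron_of_def)
  have "(LINT x : {x. \<forall>f\<in>Fs. 0 \<le> f x} | lborel. affine_basis m x * affine_basis k x) \<in> \<rat>"
  proof (intro rational_polyhedron_integral affine_basis_rat)
    show "bounded {x. \<forall>f\<in>Fs. 0 \<le> f x}"
      unfolding P[symmetric] by (rule compact_imp_bounded[OF compact_P])
  qed (auto simp: Fs_def rat_affine_vec_int_vec)
  then show ?thesis by (simp add: gram_def P)
qed

lemma S_bar_rational: "S_bar d l lam \<in> \<rat>"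
proof -
  have None: "affine_basis None = (\<lambda>_. 1)" by (simp add: affine_basis_def fun_eq_iff)
  have "boundary_moment $ None = boundary_integral d l lam (\<lambda>_. 1)"
    unfolding boundary_moment_def vec_lambda_beta None ..
  moreover have "Vol P = gram P $ None $ None"
    using compact_P by (simp add: Vol_def gram_def affine_basis_def set_lebesgue_integral_def)
  ultimately have "S_bar d l lam = boundary_moment $ None / gram P $ None $ None"
    by (simp add: S_bar_def)
  then show ?thesis
    using boundary_moment_rational[of None] gram_rational[of None None] by (simp add: Rats_divide)
qed

text \<open>The constant \<open>S_bar\<close> shifts the \<open>None\<close> coordinate, so the
  condition defining \<theta> becomes the linear system
  \<open>gram P *v (a + s) = boundary_moment\<close> with
  \<open>s = axis None (S_bar d l lam)\<close>.\<close>

lemma extremal_functional_affine: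
  "extremal_functional d l lam (affine_comb a) (affine_comb b)
    = b \<bullet> (boundary_moment - gram P *v (a + axis None (S_bar d l lam)))"
proof -
  have "S_bar d l lam + affine_comb a x = affine_comb (a + axis None (S_bar d l lam)) x" for x
    by (simp add: affine_comb_add[symmetric] affine_comb_const)
  then show ?thesis
    by (simp add: extremal_functional_def boundary_integral_affine
        affine_comb_mult_integral[OF compact_P] inner_diff_right)
qed

text \<open>Invertibility of the Gram matrix gives the existence and uniqueness that the definite
  description \<open>theta\<close> requires. Cramer's rule then makes the solution rational.\<close>

lemma theta_rational:
  obtains a where "theta d l lam = affine_comb a" "\<And>m. a $ m \<in> \<rat>"
proof -
  let ?A = "gram P"
  have det: "det ?A \<noteq> 0" by (rule gram_nonsingular[OF compact_P interior_P])
  then have "invertible ?A" by (simp add: invertible_det_nz)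
  then obtain B where B: "?A ** B = mat 1" "B ** ?A = mat 1" unfolding invertible_def by blast
  define s :: "real ^ 'n option" where "s = axis None (S_bar d l lam)"
  define a where "a = B *v boundary_moment - s"
  have Aa: "?A *v (a + s) = boundary_moment"
    by (simp add: a_def matrix_vector_mul_assoc B)
  have iff: "(\<forall>u. affine_function u \<longrightarrow> extremal_functional d l lam (affine_comb b) u = 0) \<longleftrightarrow>
    ?A *v (b + s) = boundary_moment" for b
  proof
    assume L: "\<forall>u. affine_function u \<longrightarrow> extremal_functional d l lam (affine_comb b) u = 0"
    \<comment> \<open>Tested against its own residual, the functional returns the squared norm of
      the residual.\<close>
    let ?v = "boundary_moment - ?A *v (b + s)"
    have "extremal_functional d l lam (affine_comb b) (affine_comb ?v) = 0"
      using L affine_function_iff by blast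
    then have "?v \<bullet> ?v = 0" unfolding extremal_functional_affine s_def[symmetric] .
    then show "?A *v (b + s) = boundary_moment" by simp
  next
    assume "?A *v (b + s) = boundary_moment"
    then show "\<forall>u. affine_function u \<longrightarrow> extremal_functional d l lam (affine_comb b) u = 0"
      unfolding affine_function_iff s_def by (auto simp: extremal_functional_affine)
  qed
  have "theta d l lam = affine_comb a"
    unfolding theta_def
  proof (rule the_equality)
    show "affine_function (affine_comb a) \<and>
        (\<forall>u. affine_function u \<longrightarrow> extremal_functional d l lam (affine_comb a) u = 0)"
      using iff[of a] Aa affine_function_iff by blast
    fix \<theta> assume \<theta>: "affine_function \<theta> \<and>
        (\<forall>u. affine_function u \<longrightarrow> extremal_functional d l lam \<theta> u = 0)"
    then obtain b where b: "\<theta> = affine_comb b" using affine_function_iff by blast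
    then have "?A *v (b + s) = ?A *v (a + s)" using \<theta> iff[of b] Aa by simp
    then have "B *v (?A *v (b + s)) = B *v (?A *v (a + s))" by simp
    then have "b = a" by (simp add: matrix_vector_mul_assoc B)
    then show "\<theta> = affine_comb a" using b by simp
  qed
  moreover have "a $ m \<in> \<rat>" for m
  proof -
    have "(a + s) $ m \<in> \<rat>"
      by (rule rational_linear_system[OF det gram_rational boundary_moment_rational Aa])
    moreover have "s $ m \<in> \<rat>" using S_bar_rational by (simp add: s_def axis_def)
    ultimately show ?thesis using Rats_diff by fastforce
  qed
  ultimately show ?thesis using that by blast
qed

section \<open>Lattice points and the generator of the extremal action\<close>

lemma finite_lattice_points:
  assumes "i \<ge> 1"
  shows "finite (lattice_points P i)"
proof -
  obtain B where B: "\<And>x. x \<in> P \<Longrightarrow> norm x \<le> B"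
    using compact_imp_bounded[OF compact_P] unfolding bounded_iff by blast
  define f :: "real ^ 'n \<Rightarrow> 'n \<Rightarrow> int" where "f = (\<lambda>a k. \<lfloor>real i * a $ k\<rfloor>)"
  have fi: "real_of_int (f a k) = real i * a $ k" if "a \<in> lattice_points P i" for a k
    using that by (auto simp: f_def lattice_points_def elim!: Ints_cases)
  have "f ` lattice_points P i \<subseteq> PiE UNIV (\<lambda>_. {-\<lceil>real i * B\<rceil>..\<lceil>real i * B\<rceil>})"
  proof (clarsimp simp: PiE_UNIV_domain)
    fix a k assume a: "a \<in> lattice_points P i"
    then have "\<bar>a $ k\<bar> \<le> B" using B[of a] component_le_norm_cart[of a k] by (auto simp: lattice_points_def)
    then have "\<bar>real i * a $ k\<bar> \<le> real i * B" by (simp add: abs_mult mult_left_mono)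
    then have "\<bar>real_of_int (f a k)\<bar> \<le> real i * B" by (simp add: fi[OF a])
    then show "- \<lceil>real i * B\<rceil> \<le> f a k \<and> f a k \<le> \<lceil>real i * B\<rceil>" by linarith
  qed
  moreover have "finite (PiE (UNIV :: 'n set) (\<lambda>_. {-\<lceil>real i * B\<rceil>..\<lceil>real i * B\<rceil>}))"
    by (intro finite_PiE) auto
  ultimately have "finite (f ` lattice_points P i)" by (rule finite_subset)
  moreover have "inj_on f (lattice_points P i)"
  proof (rule inj_onI)
    fix a b assume ab: "a \<in> lattice_points P i" "b \<in> lattice_points P i" "f a = f b"
    then have "real i * a $ k = real i * b $ k" for k using fi by metis
    \<comment> \<open>For i = 0 the integrality condition is void and the set would be all of
      P.\<close>
    then show "a = b" using assms by (simp add: vec_eq_iff)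
  qed
  ultimately show ?thesis by (rule finite_imageD)
qed

lemma lattice_point_rational:
  assumes "i \<ge> 1" "a \<in> lattice_points P i"
  shows "a $ k \<in> \<rat>"
proof -
  have "real i * a $ k \<in> \<rat>" using assms Ints_subset_Rats by (auto simp: lattice_points_def)
  then have "real i * a $ k / real i \<in> \<rat>" by (rule Rats_divide) simp
  then show ?thesis using assms by simp
qed

lemma theta_at_lattice_point_rational:
  assumes "i \<ge> 1" "a \<in> lattice_points P i"
  shows "theta d l lam a \<in> \<rat>"
proof -
  obtain c where c: "theta d l lam = affine_comb c" "\<And>m. c $ m \<in> \<rat>" using theta_rational by blast
  then show ?thesis
    using lattice_point_rational[OF assms] by (auto simp: c(1) affine_comb_eq intro!: Rats_add Rats_sum)
qed

text \<open>A real version of \<open>beta_generator\<close>, for which rationality can be stated;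
  \<open>theta_tilde\<close> is its quotient by i.\<close>

definition reduced_theta :: "nat \<Rightarrow> real ^ 'n \<Rightarrow> real" where
  "reduced_theta i a = (if a \<in> lattice_points P i then theta d l lam a - theta_bar d l lam i else 0)"

lemma beta_generator_eq: "beta_generator d l lam i = (\<lambda>a. complex_of_real (reduced_theta i a))"
  by (auto simp: beta_generator_def reduced_theta_def fun_eq_iff)

lemma reduced_theta_rational:
  assumes "i \<ge> 1"
  shows "reduced_theta i a \<in> \<rat>"
  unfolding reduced_theta_def theta_bar_def
  using theta_at_lattice_point_rational[OF assms] by (auto intro!: Rats_diff Rats_divide Rats_sum)

text \<open>Subtracting the mean makes the generator orthogonal to the constant vector, as the
  projection in \<open>compact_phases\<close> requires.\<close>

lemma sum_reduced_theta:
  assumes "i \<ge> 1"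
  shows "(\<Sum>a\<in>lattice_points P i. reduced_theta i a) = 0"
proof (cases "lattice_points P i = {}")
  case False
  then have "ehrhart P i \<noteq> 0" using finite_lattice_points[OF assms] by (simp add: ehrhart_def)
  then show ?thesis
    by (simp add: reduced_theta_def theta_bar_def sum_subtractf ehrhart_def)
qed auto

lemma orthogonal_to_point:
  assumes w: "w \<in> sl_torus_lie (lattice_points P i)"
    "trace_form (lattice_points P i) w (beta_generator d l lam i) = 0"
  shows "(\<Sum>a\<in>lattice_points P i. w a
    * complex_of_real ((\<kappa> *\<^sub>R (d_vec d l lam i + s *\<^sub>R theta_tilde d l lam i)) a)) = 0"
proof -
  have "(\<Sum>a\<in>lattice_points P i. w a
      * complex_of_real ((\<kappa> *\<^sub>R (d_vec d l lam i + s *\<^sub>R theta_tilde d l lam i)) a))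
    = (\<Sum>a\<in>lattice_points P i. complex_of_real \<kappa> * w a
        + complex_of_real (\<kappa> * s / real i) * (w a * beta_generator d l lam i a))"
    by (intro sum.cong)
      (auto simp: scaleR_fun_def d_vec_def theta_tilde_def beta_generator_def distrib_left mult_ac)
  also have "\<dots> = complex_of_real \<kappa> * (\<Sum>a\<in>lattice_points P i. w a)
      + complex_of_real (\<kappa> * s / real i) * (\<Sum>a\<in>lattice_points P i. w a * beta_generator d l lam i a)"
    by (simp only: sum.distrib sum_distrib_left)
  also have "\<dots> = 0" using w by (simp add: sl_torus_lie_def trace_form_def)
  finally show ?thesis .
qed

lemma semistable_if_in_Ch:
  assumes "i \<ge> 1" "\<kappa> *\<^sub>R (d_vec d l lam i + s *\<^sub>R theta_tilde d l lam i) \<in> Ch P i"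
  shows "semistable (toric_relative_torus d l lam i) (toric_chow_form P i)"
proof (rule semistable_if_weight_polytope_orthogonal[OF finite_lattice_points[OF assms(1)]
      assms(2)[unfolded Ch_def]])
  fix t assume "t \<in> toric_relative_torus d l lam i"
  then obtain w where "t = (\<lambda>j. exp (w j))" "w \<in> sl_torus_lie (lattice_points P i)"
    "trace_form (lattice_points P i) w (beta_generator d l lam i) = 0"
    by (auto simp: toric_relative_torus_def relative_torus_def)
  then show "\<exists>w. t = (\<lambda>j. exp (w j)) \<and> (\<Sum>a\<in>lattice_points P i. w a
      * complex_of_real ((\<kappa> *\<^sub>R (d_vec d l lam i + s *\<^sub>R theta_tilde d l lam i)) a)) = 0"
    using orthogonal_to_point by blast
qed

lemma stable_if_in_rel_interior_Ch:
  assumes "i \<ge> 1" "\<kappa> *\<^sub>R (d_vec d l lam i + s *\<^sub>R theta_tilde d l lam i) \<in> rel_interior (Ch P i)"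
  shows "stable (toric_relative_torus d l lam i) (toric_chow_form P i)"
  unfolding toric_relative_torus_def beta_generator_eq
proof (rule stable_if_rel_interior_orthogonal[OF finite_lattice_points[OF assms(1)]
      assms(2)[unfolded Ch_def] reduced_theta_rational[OF assms(1)] sum_reduced_theta[OF assms(1)]])
  fix w assume "w \<in> sl_torus_lie (lattice_points P i)"
    "trace_form (lattice_points P i) w (\<lambda>a. complex_of_real (reduced_theta i a)) = 0"
  then show "(\<Sum>a\<in>lattice_points P i. w a
      * complex_of_real ((\<kappa> *\<^sub>R (d_vec d l lam i + s *\<^sub>R theta_tilde d l lam i)) a)) = 0"
    unfolding beta_generator_eq[symmetric] by (rule orthogonal_to_point)
qed

end

theorem theorem1p9:
  fixes d :: nat and l :: "nat \<Rightarrow> int ^ 'n" and lam :: "nat \<Rightarrow> int"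
    and \<Delta> :: "(real ^ 'n) set"
  assumes "delzant_polytope d l lam"
    and "\<Delta> = polyhedron_of d l lam"
  shows "((\<exists>i0\<ge>1. \<forall>i\<ge>i0. \<exists>s::real.
            (real i ^ CARD('n) * fact (CARD('n) + 1) * Vol \<Delta> / real (ehrhart \<Delta> i)) *\<^sub>R
              (d_vec d l lam i + s *\<^sub>R theta_tilde d l lam i) \<in> Ch \<Delta> i)
          \<longrightarrow> asymptotically_relatively_chow_semistable d l lam)
       \<and> ((\<exists>i0\<ge>1. \<forall>i\<ge>i0. \<exists>s::real.
            (real i ^ CARD('n) * fact (CARD('n) + 1) * Vol \<Delta> / real (ehrhart \<Delta> i)) *\<^sub>R
              (d_vec d l lam i + s *\<^sub>R theta_tilde d l lam i) \<in> rel_interior (Ch \<Delta> i))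
          \<longrightarrow> asymptotically_relatively_chow_stable d l lam)"
proof (intro conjI impI; elim exE conjE)
  interpret delzant d l lam by standard (rule assms(1))
  \<comment> \<open>The bound passes to every i \<ge> i0 and keeps the set of lattice points
    finite.\<close>
  fix i0 :: nat assume i0: "i0 \<ge> 1"
  show "asymptotically_relatively_chow_semistable d l lam"
    if "\<forall>i\<ge>i0. \<exists>s::real.
      (real i ^ CARD('n) * fact (CARD('n) + 1) * Vol \<Delta> / real (ehrhart \<Delta> i)) *\<^sub>R
        (d_vec d l lam i + s *\<^sub>R theta_tilde d l lam i) \<in> Ch \<Delta> i"
    unfolding asymptotically_relatively_chow_semistable_def
  proof (rule eventually_sequentiallyI[of i0])
    fix i assume "i0 \<le> i"
    then show "semistable (toric_relative_torus d l lam i) (toric_chow_form P i)"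
      using that i0 semistable_if_in_Ch[of i] unfolding assms(2) by (meson order_trans)
  qed
  show "asymptotically_relatively_chow_stable d l lam"
    if "\<forall>i\<ge>i0. \<exists>s::real.
      (real i ^ CARD('n) * fact (CARD('n) + 1) * Vol \<Delta> / real (ehrhart \<Delta> i)) *\<^sub>R
        (d_vec d l lam i + s *\<^sub>R theta_tilde d l lam i) \<in> rel_interior (Ch \<Delta> i)"
    unfolding asymptotically_relatively_chow_stable_def
  proof (rule eventually_sequentiallyI[of i0])
    fix i assume "i0 \<le> i"
    then show "stable (toric_relative_torus d l lam i) (toric_chow_form P i)"
      using that i0 stable_if_in_rel_interior_Ch[of i] unfolding assms(2) by (meson order_trans)
  qed
qed

end
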